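(* Assume: $(A,B)$ is stabilizable; $\mathcal{Y}\subseteq\mathbb{R}^{n_y}$ is a compact polyhedron with $0\in\mathrm{Int}\,\mathcal{Y}$; $G_z$ has full rank; $Q=Q^T\succeq0$ with $(A,Q)$ observable and $R=R^T\succ0$; $P=P^T\succeq 0$ and, for all $(x,v)\in\mathcal{T}$, with $\delta x=x-\bar x_v$, $\|(A-BK)\delta x\|_P^2-\|\delta x\|_P^2\le-\|\delta x\|^2_{Q+K^TRK}$; for all $(x,v)\in\mathcal{T}$, $(Ax+B\kappa_N(x,v),v)\in\mathcal{T}$ and $Cx+D\kappa_N(x,v)\in\mathcal{Y}$; $\Sigma\subset\mathrm{Int}\,\Gamma_N$; and $\mathcal{F}\subseteq\Gamma_N$ is closed, convex, polyhedral and satisfies $\Sigma\subset\mathrm{Int}\,\mathcal{F}$. Let $r\in\mathbb{R}^{n_z}$ be a constant reference. Consider the closed-loop system $$x_{k+1}=f(x_k,v_k),\qquad v_{k+1}=g(x_{k+1},v_k),\qquad k\in\mathbb{N},$$ with state $(x_k,v_k)\in\Lambda$. Then the point $(x^*,v^* )$, where $x^*=G_xv^*$, is an asymptotically stable equilibrium of this system, and if $x_0\in\Pi_x\Phi$ and $v_0=\bar g(x_0)$, then $\lim_{k\to\infty}(x_k,v_k)=(x^*,v^* )$.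
   Context: System: $x_{k+1}=Ax_k+Bu_k$, $y_k=Cx_k+Du_k$, $z_k=Ex_k+Fu_k$, with $x_k\in\mathbb{R}^{n_x}$, $u_k\in\mathbb{R}^{n_u}$, constrained output $y_k\in\mathbb{R}^{n_y}$, tracking output $z_k\in\mathbb{R}^{n_z}$. $\mathbb{N}$ includes $0$. Constraint: $y_k\in\mathcal{Y}$. Equilibria: let $Z=\begin{bmatrix} A-I & B & 0 \\ E & F & -I \end{bmatrix}$ and let $G=[G_x^T\ G_u^T\ G_z^T]^T$ be a matrix with $n_v$ columns forming a basis of $\ker Z$ (block rows of sizes $n_x,n_u,n_z$). For $v\in\mathbb{R}^{n_v}$ put $\bar x_v=G_xv$, $\bar u_v=G_uv$, $\bar z_v=G_zv$. Let $G_y=CG_x+DG_u$, fix $\epsilon\in(0,1)$, let $\mathcal{V}_\epsilon=\{v\in\mathbb{R}^{n_v}\mid G_yv\in(1-\epsilon)\mathcal{Y}\}$ and $\Sigma=\{(x,v)\mid x=G_xv,\ v\in\mathcal{V}_\epsilon\}$. MPC: $N\ge1$ is the horizon, $\mathcal{T}\subseteq\mathbb{R}^{n_x}\times\mathbb{R}^{n_v}$ is a polyhedral terminal set, $K\in\mathbb{R}^{n_u\times n_x}$ is a gain, $\kappa_N(x,v)=\bar u_v-K(x-\bar x_v)$, and $\|x\|_P=\sqrt{x^TPx}$. The optimal control problem with parameter $(x,v)$ is to minimize over $\mu=(\mu_0,\dots,\mu_{N-1})$ the cost $\|\xi_N-\bar x_v\|_P^2+\sum_{i=0}^{N-1}\left(\|\xi_i-\bar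 x_v\|_Q^2+\|\mu_i-\bar u_v\|_R^2\right)$ subject to $\xi_0=x$, $\xi_{i+1}=A\xi_i+B\mu_i$, $C\xi_i+D\mu_i\in\mathcal{Y}$ for $i=0,\dots,N-1$, and $(\xi_N,v)\in\mathcal{T}$. $\Gamma_N$ is the set of $(x,v)$ for which these constraints are feasible. For $(x,v)\in\Gamma_N$, $\kappa(x,v)=\mu_0^\star(x,v)$ is the first element of the minimizer, and $f(x,v)=Ax+B\kappa(x,v)$. Feasibility Governor: $v^*=v_r^*$ is a fixed chosen element of $\mathrm{argmin}_{v\in\mathcal{V}_\epsilon}\|G_zv-r\|_2^2$. Let $\psi(v,r)=\|G_zv-r\|_2^2$ if $G_z$ is injective, and $\psi(v,r)=\|v-v_r^*\|_2^2$ otherwise. Let $\Phi=\mathcal{F}\cap(\mathbb{R}^{n_x}\times\mathcal{V}_\epsilon)$, $\Lambda=\Gamma_N\cap(\mathbb{R}^{n_x}\times\mathcal{V}_\epsilon)$, $\Pi_x\Phi=\{x\mid\exists v:(x,v)\in\Phi\}$. For $x\in\Pi_x\Phi$, $\bar g(x)=\mathrm{argmin}\{\psi(v,r)\mid (x,v)\in\Phi\}$; and $g(x,v)=\bar g(x)$ if $(x,v)\in\Phi$, $g(x,v)=v$ if $(x,v)\in\Lambda\setminus\Phi$. *)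

theory Defs
  imports "HOL-Analysis.Analysis"
begin

text \<open>Schur stability is a condition on all complex eigenvalues of the real matrix \<open>M\<close>.\<close>

definition schur_stable :: "real^'n^'n \<Rightarrow> bool" where
  "schur_stable M \<longleftrightarrow>
     (\<forall>(l::complex) w. w \<noteq> 0 \<and> map_matrix complex_of_real M *v w = l *s w \<longrightarrow> norm l < 1)"

definition stabilizable :: "real^'n^'n \<Rightarrow> real^'m^'n \<Rightarrow> bool" where
  "stabilizable A B \<longleftrightarrow> (\<exists>K :: real^'n^'m. schur_stable (A - B ** K))"

text \<open>Initial states of \<open>x\<^sub>k\<^sub>+\<^sub>1 = A x\<^sub>k\<close>, \<open>w\<^sub>k = H x\<^sub>k\<close> are determined by the output sequence. The
  powers of \<open>A\<close> are iterates of \<open>(*v) A\<close> because \<open>(^)\<close> on vectors is componentwise.\<close>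

definition observable :: "real^'n^'n \<Rightarrow> real^'n^'p \<Rightarrow> bool" where
  "observable A H \<longleftrightarrow>
     (\<forall>x x'. (\<forall>k. H *v (((*v) A ^^ k) x) = H *v (((*v) A ^^ k) x')) \<longrightarrow> x = x')"

definition sym_psd :: "real^'n^'n \<Rightarrow> bool" where
  "sym_psd M \<longleftrightarrow> transpose M = M \<and> (\<forall>x. 0 \<le> x \<bullet> (M *v x))"

definition sym_pd :: "real^'n^'n \<Rightarrow> bool" where
  "sym_pd M \<longleftrightarrow> transpose M = M \<and> (\<forall>x. x \<noteq> 0 \<longrightarrow> 0 < x \<bullet> (M *v x))"

definition wnorm :: "real^'n^'n \<Rightarrow> real^'n \<Rightarrow> real" where
  "wnorm P x = sqrt (x \<bullet> (P *v x))"

definition full_rank :: "real^'n^'m \<Rightarrow> bool" where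
  "full_rank M \<longleftrightarrow> rank M = min CARD('m) CARD('n)"


text \<open>The kernel of the block matrix with rows \<open>[A - I, B, 0]\<close> and \<open>[E, F, -I]\<close>, with block vectors
  represented as triples.\<close>

definition eq_kernel ::
  "real^'nx^'nx \<Rightarrow> real^'nu^'nx \<Rightarrow> real^'nx^'nz \<Rightarrow> real^'nu^'nz \<Rightarrow>
     ((real^'nx) \<times> (real^'nu) \<times> (real^'nz)) set" where
  "eq_kernel A B E F =
     {(x, u, z). (A - mat 1) *v x + B *v u = 0 \<and> E *v x + F *v u - z = 0}"

definition block_column ::
  "real^'nv^'nx \<Rightarrow> real^'nv^'nu \<Rightarrow> real^'nv^'nz \<Rightarrow> 'nv \<Rightarrow> (real^'nx) \<times> (real^'nu) \<times> (real^'nz)" where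
  "block_column Gx Gu Gz j = (column j Gx, column j Gu, column j Gz)"

text \<open>Injectivity excludes repeated columns, which \<^const>\<open>range\<close> would hide.\<close>

definition columns_basis ::
  "real^'nv^'nx \<Rightarrow> real^'nv^'nu \<Rightarrow> real^'nv^'nz \<Rightarrow>
     ((real^'nx) \<times> (real^'nu) \<times> (real^'nz)) set \<Rightarrow> bool" where
  "columns_basis Gx Gu Gz S \<longleftrightarrow>
     inj (block_column Gx Gu Gz) \<and> independent (range (block_column Gx Gu Gz)) \<and>
     span (range (block_column Gx Gu Gz)) = S"

definition admissible_refs ::
  "real^'nv^'ny \<Rightarrow> real \<Rightarrow> (real^'ny) set \<Rightarrow> (real^'nv) set" where
  "admissible_refs Gy eps Y = {v. Gy *v v \<in> (*\<^sub>R) (1 - eps) ` Y}"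

definition eq_manifold ::
  "real^'nv^'nx \<Rightarrow> (real^'nv) set \<Rightarrow> ((real^'nx) \<times> (real^'nv)) set" where
  "eq_manifold Gx V = {(x, v). x = Gx *v v \<and> v \<in> V}"


text \<open>An input sequence is a function \<open>\<mu> :: nat \<Rightarrow> real^'nu\<close>; only \<open>\<mu> 0, \<dots>, \<mu> (N - 1)\<close> enter the
  constraints and the cost.\<close>

primrec pred_state ::
  "real^'nx^'nx \<Rightarrow> real^'nu^'nx \<Rightarrow> real^'nx \<Rightarrow> (nat \<Rightarrow> real^'nu) \<Rightarrow> nat \<Rightarrow> real^'nx" where
  "pred_state A B x \<mu> 0 = x"
| "pred_state A B x \<mu> (Suc i) = A *v pred_state A B x \<mu> i + B *v \<mu> i"

definition ocp_feasible ::
  "real^'nx^'nx \<Rightarrow> real^'nu^'nx \<Rightarrow> real^'nx^'ny \<Rightarrow> real^'nu^'ny \<Rightarrow> (real^'ny) set \<Rightarrow>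
     ((real^'nx) \<times> (real^'nv)) set \<Rightarrow> nat \<Rightarrow> real^'nx \<Rightarrow> real^'nv \<Rightarrow> (nat \<Rightarrow> real^'nu) \<Rightarrow> bool" where
  "ocp_feasible A B C D Y T N x v \<mu> \<longleftrightarrow>
     (\<forall>i<N. C *v pred_state A B x \<mu> i + D *v \<mu> i \<in> Y) \<and> (pred_state A B x \<mu> N, v) \<in> T"

definition ocp_cost ::
  "real^'nx^'nx \<Rightarrow> real^'nu^'nx \<Rightarrow> real^'nv^'nx \<Rightarrow> real^'nv^'nu \<Rightarrow>
     real^'nx^'nx \<Rightarrow> real^'nx^'nx \<Rightarrow> real^'nu^'nu \<Rightarrow> nat \<Rightarrow>
     real^'nx \<Rightarrow> real^'nv \<Rightarrow> (nat \<Rightarrow> real^'nu) \<Rightarrow> real" where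
  "ocp_cost A B Gx Gu P Q R N x v \<mu> =
     (wnorm P (pred_state A B x \<mu> N - Gx *v v))\<^sup>2 +
     (\<Sum>i<N. (wnorm Q (pred_state A B x \<mu> i - Gx *v v))\<^sup>2 + (wnorm R (\<mu> i - Gu *v v))\<^sup>2)"

definition ocp_params ::
  "real^'nx^'nx \<Rightarrow> real^'nu^'nx \<Rightarrow> real^'nx^'ny \<Rightarrow> real^'nu^'ny \<Rightarrow> (real^'ny) set \<Rightarrow>
     ((real^'nx) \<times> (real^'nv)) set \<Rightarrow> nat \<Rightarrow> ((real^'nx) \<times> (real^'nv)) set" where
  "ocp_params A B C D Y T N = {(x, v). \<exists>\<mu>. ocp_feasible A B C D Y T N x v \<mu>}"

text \<open>Minimizers are arbitrary at indices \<open>\<ge> N\<close>. Under \<open>R \<succ> 0\<close> their first \<open>N\<close> entries are unique,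
  so for \<open>N \<ge> 1\<close> the value does not depend on the choice made by \<^const>\<open>arg_min\<close>.\<close>

definition mpc_law ::
  "real^'nx^'nx \<Rightarrow> real^'nu^'nx \<Rightarrow> real^'nx^'ny \<Rightarrow> real^'nu^'ny \<Rightarrow> real^'nv^'nx \<Rightarrow> real^'nv^'nu \<Rightarrow>
     (real^'ny) set \<Rightarrow> ((real^'nx) \<times> (real^'nv)) set \<Rightarrow> real^'nx^'nx \<Rightarrow> real^'nx^'nx \<Rightarrow> real^'nu^'nu \<Rightarrow>
     nat \<Rightarrow> real^'nx \<Rightarrow> real^'nv \<Rightarrow> real^'nu" where
  "mpc_law A B C D Gx Gu Y T P Q R N x v =
     arg_min (ocp_cost A B Gx Gu P Q R N x v) (ocp_feasible A B C D Y T N x v) 0"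

definition terminal_law ::
  "real^'nv^'nx \<Rightarrow> real^'nv^'nu \<Rightarrow> real^'nx^'nu \<Rightarrow> real^'nx \<Rightarrow> real^'nv \<Rightarrow> real^'nu" where
  "terminal_law Gx Gu K x v = Gu *v v - K *v (x - Gx *v v)"


definition fg_objective ::
  "real^'nv^'nz \<Rightarrow> real^'nv \<Rightarrow> real^'nz \<Rightarrow> real^'nv \<Rightarrow> real" where
  "fg_objective Gz vstar r v =
     (if inj ((*v) Gz) then (norm (Gz *v v - r))\<^sup>2 else (norm (v - vstar))\<^sup>2)"

definition fg_select :: "('v \<Rightarrow> real) \<Rightarrow> ('x \<times> 'v) set \<Rightarrow> 'x \<Rightarrow> 'v" where
  "fg_select \<psi> \<Phi> x = arg_min \<psi> (\<lambda>v. (x, v) \<in> \<Phi>)"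

text \<open>Only pairs in \<open>\<Lambda> \<supseteq> \<Phi>\<close> matter; outside \<open>\<Lambda>\<close> the value is a dummy.\<close>

definition fg_update :: "('v \<Rightarrow> real) \<Rightarrow> ('x \<times> 'v) set \<Rightarrow> 'x \<Rightarrow> 'v \<Rightarrow> 'v" where
  "fg_update \<psi> \<Phi> x v = (if (x, v) \<in> \<Phi> then fg_select \<psi> \<Phi> x else v)"


text \<open>Stability and local attractivity of \<open>p\<close> for \<open>s\<^sub>k\<^sub>+\<^sub>1 = h s\<^sub>k\<close> with state space \<open>X\<close>; perturbations of
  \<open>p\<close> range over \<open>X\<close> only. The first conjunct says that \<open>h\<close> is a dynamical system on \<open>X\<close>.\<close>

definition asymp_stable_equilibrium ::
  "'s::metric_space set \<Rightarrow> ('s \<Rightarrow> 's) \<Rightarrow> 's \<Rightarrow> bool" where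
  "asymp_stable_equilibrium X h p \<longleftrightarrow>
     h ` X \<subseteq> X \<and> p \<in> X \<and> h p = p \<and>
     (\<forall>\<epsilon>>0. \<exists>\<delta>>0. \<forall>s\<in>X. dist s p < \<delta> \<longrightarrow> (\<forall>k. dist ((h ^^ k) s) p < \<epsilon>)) \<and>
     (\<exists>\<delta>>0. \<forall>s\<in>X. dist s p < \<delta> \<longrightarrow> (\<lambda>k. (h ^^ k) s) \<longlonglongrightarrow> p)"

end

theory Submission
  imports Defs
begin

text \<open>Write \<open>W(x,v)\<close> for the square root of the optimal cost of the control problem with parameter
\<open>(x,v)\<close>. Everything rests on three properties of \<open>W\<close>.

\<^item> It is globally Lipschitz on the set \<open>\<Gamma>\<close> of feasible parameters (\<open>root_value_lipschitz\<close>). The square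
  root of the cost is a seminorm of a linear function of \<open>(x,v,\<mu>)\<close>, so it suffices that the feasible
  input sequences depend on \<open>(x,v)\<close> in a Lipschitz way. This is where polyhedrality enters:
  Fourier-Motzkin elimination, done one input at a time along the horizon, shows that all sets
  involved are polyhedra and that their fibres move at most proportionally to the parameter
  (\<open>polyhedron_projection_lipschitz\<close>, \<open>ocp_feasible_lipschitz\<close>).

\<^item> For fixed \<open>v\<close>, one closed-loop step lowers \<open>W\<^sup>2\<close> by at least the current stage cost: drop the first
  input of the optimal sequence and append the terminal controller (\<open>closed_loop_descent\<close>).

\<^item> It is comparable with the distance \<open>\<parallel>x - G\<^sub>x v\<parallel>\<close> to the equilibrium. From above this is the
  Lipschitz property, because \<open>W\<close> vanishes at equilibria: the terminal controller drives any point of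
  the closed set \<open>\<T>\<close> to its equilibrium, which therefore lies in \<open>\<T>\<close>, so that resting there is
  feasible. From below it is observability, because stage costs that are small over a long enough
  window force a small initial deviation (\<open>observability_estimate\<close>).

Together they show that along a window of fixed length \<open>W\<close> contracts, up to a multiple of the total
variation of \<open>v\<close> over the window (\<open>root_value_window_contraction\<close>). Thus the state tracks \<open>G\<^sub>x v\<^sub>k\<close> as
soon as the increments of \<open>v\<^sub>k\<close> tend to zero.

The governor provides exactly that. In both of its branches the objective \<open>\<psi>\<close> is strongly convex, and
\<open>v\<^sup>*\<close> is its unique minimizer over the admissible references. Since \<open>v\<^sub>k\<close> is a candidate whenever
\<open>v\<^sub>k\<^sub>+\<^sub>1\<close> is chosen by minimization over a convex set, \<open>\<psi>(v\<^sub>k) - \<psi>(v\<^sub>k\<^sub>+\<^sub>1)\<close> dominates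
\<open>\<parallel>v\<^sub>k - v\<^sub>k\<^sub>+\<^sub>1\<parallel>\<^sup>2\<close>; as \<open>\<psi>(v\<^sub>k)\<close> converges, the increments vanish. Hence \<open>x\<^sub>k\<close> comes close to \<open>G\<^sub>x v\<^sub>k\<close>, and
since the equilibria with \<open>v\<close> in a compact set lie in \<open>Int \<F>\<close> with a uniform margin, the governor may
from then on move by a fixed fraction towards \<open>v\<^sup>*\<close>. So \<open>\<psi>(v\<^sub>k) - \<psi>(v\<^sup>*)\<close> decays geometrically, \<open>v\<^sub>k\<close>
tends to \<open>v\<^sup>*\<close> and \<open>x\<^sub>k\<close> to \<open>G\<^sub>x v\<^sup>*\<close>, from every initial state in \<open>\<Lambda>\<close> (\<open>step_converges\<close>).

For stability, a state close to \<open>(G\<^sub>x v\<^sup>*, v\<^sup>*)\<close> has small \<open>W\<close>, so its successor is still close enough for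
\<open>v\<^sup>*\<close> to be a candidate. The reference is then \<open>v\<^sup>*\<close> after one step, and the nonincreasing value
\<open>W(\<cdot>,v\<^sup>*)\<close> keeps the state near \<open>G\<^sub>x v\<^sup>*\<close> and the reference at \<open>v\<^sup>*\<close> forever (\<open>step_stable\<close>).\<close>

section \<open>Projections of polyhedra\<close>

lemma polyhedron_iff_finite_inequalities:
  fixes S :: "'a::euclidean_space set"
  shows "polyhedron S \<longleftrightarrow> (\<exists>I. finite I \<and> S = {y. \<forall>(a,c)\<in>I. a \<bullet> y \<le> c})"
proof
  assume "polyhedron S"
  then obtain H where H: "finite H" "S = \<Inter>H" "\<forall>h\<in>H. \<exists>a b. a \<noteq> 0 \<and> h = {x. a \<bullet> x \<le> b}"
    unfolding polyhedron_def by blast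
  from H(3) obtain a b where ab: "\<And>h. h \<in> H \<Longrightarrow> h = {x. a h \<bullet> x \<le> b h}" by metis
  have "S = {y. \<forall>(a,c)\<in>(\<lambda>h. (a h, b h)) ` H. a \<bullet> y \<le> c}"
    using H(2) ab by blast
  with H(1) show "\<exists>I. finite I \<and> S = {y. \<forall>(a,c)\<in>I. a \<bullet> y \<le> c}" by blast
next
  assume "\<exists>I. finite I \<and> S = {y. \<forall>(a,c)\<in>I. a \<bullet> y \<le> c}"
  then obtain I where I: "finite I" "S = {y. \<forall>(a,c)\<in>I. a \<bullet> y \<le> c}" by blast
  have "S = \<Inter>((\<lambda>(a,c). {y. a \<bullet> y \<le> c}) ` I)" using I(2) by auto
  moreover have "polyhedron (\<Inter>((\<lambda>(a,c). {y. a \<bullet> y \<le> c}) ` I))"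
    by (rule polyhedron_Inter) (use I(1) polyhedron_halfspace_le in auto)
  ultimately show "polyhedron S" by simp
qed

lemma polyhedron_linear_preimage:
  fixes h :: "'a::euclidean_space \<Rightarrow> 'b::euclidean_space"
  assumes "linear h" "polyhedron S"
  shows "polyhedron {x. h x \<in> S}"
proof -
  obtain I where I: "finite I" "S = {y. \<forall>(a,c)\<in>I. a \<bullet> y \<le> c}"
    using assms(2) polyhedron_iff_finite_inequalities by blast
  define J where "J = (\<lambda>(a,c). (adjoint h a, c)) ` I"
  have "{x. h x \<in> S} = {y. \<forall>(a,c)\<in>J. a \<bullet> y \<le> c}"
    unfolding J_def using I(2) adjoint_clauses[OF assms(1)] by (auto simp: split_beta)
  moreover have "finite J" unfolding J_def using I(1) by simp
  ultimately show ?thesis unfolding polyhedron_iff_finite_inequalities by blast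
qed

text \<open>Helly's theorem for rays on the line; this is the elimination step of Fourier and Motzkin.\<close>

lemma finite_intervals_meet:
  fixes l u :: "'i \<Rightarrow> real"
  assumes "finite L" "finite U" "\<And>i j. i \<in> L \<Longrightarrow> j \<in> U \<Longrightarrow> l i \<le> u j"
  shows "\<exists>t. (\<forall>i\<in>L. l i \<le> t) \<and> (\<forall>j\<in>U. t \<le> u j)"
proof (cases "L = {}")
  case True
  have "\<forall>j\<in>U. Min (insert 0 (u ` U)) \<le> u j" using assms(2) by auto
  with True show ?thesis by blast
next
  case False
  have "\<forall>i\<in>L. l i \<le> Max (l ` L)" using assms(1) by auto
  moreover have "\<forall>j\<in>U. Max (l ` L) \<le> u j" using assms False by auto
  ultimately show ?thesis by blast
qed

lemma halfspace_on_line: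
  fixes a b y :: "'a::euclidean_space" and t c :: real
  shows "a \<bullet> b > 0 \<Longrightarrow> a \<bullet> (y + t *\<^sub>R b) \<le> c \<longleftrightarrow> t \<le> (c - a \<bullet> y) / (a \<bullet> b)"
    and "a \<bullet> b < 0 \<Longrightarrow> a \<bullet> (y + t *\<^sub>R b) \<le> c \<longleftrightarrow> (c - a \<bullet> y) / (a \<bullet> b) \<le> t"
    and "a \<bullet> b = 0 \<Longrightarrow> a \<bullet> (y + t *\<^sub>R b) \<le> c \<longleftrightarrow> a \<bullet> y \<le> c"
  by (simp_all add: inner_right_distrib pos_le_divide_eq neg_divide_le_eq le_diff_eq add.commute)

text \<open>On the line \<open>y + \<real>b\<close> each inequality bounds \<open>t\<close> from above (\<open>U\<close>), from below (\<open>L\<close>), or does not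
  involve \<open>t\<close> (\<open>Z\<close>). A feasible \<open>t\<close> exists iff every lower bound is below every upper bound, and those
  conditions (\<open>J\<close>) are again linear in \<open>y\<close>.\<close>

lemma polyhedron_eliminate_direction:
  fixes S :: "'a::euclidean_space set"
  assumes "polyhedron S"
  shows "polyhedron {y. \<exists>t. y + t *\<^sub>R b \<in> S}"
proof -
  obtain I where I: "finite I" "S = {y. \<forall>(a,c)\<in>I. a \<bullet> y \<le> c}"
    using assms polyhedron_iff_finite_inequalities by blast
  define U where "U = {p\<in>I. fst p \<bullet> b > 0}"
  define L where "L = {p\<in>I. fst p \<bullet> b < 0}"
  define Z where "Z = {p\<in>I. fst p \<bullet> b = 0}"
  define J where "J = (\<lambda>(p,q). (fst p /\<^sub>R (fst p \<bullet> b) - fst q /\<^sub>R (fst q \<bullet> b),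
      snd p / (fst p \<bullet> b) - snd q / (fst q \<bullet> b))) ` (U \<times> L)"
  have fin: "finite U" "finite L" "finite Z" "finite J"
    using I(1) by (auto simp: U_def L_def Z_def J_def)
  define l where "l y p = (snd p - fst p \<bullet> y) / (fst p \<bullet> b)" for y and p :: "'a \<times> real"
  have split: "y + t *\<^sub>R b \<in> S \<longleftrightarrow>
      (\<forall>p\<in>U. t \<le> l y p) \<and> (\<forall>q\<in>L. l y q \<le> t) \<and> (\<forall>p\<in>Z. fst p \<bullet> y \<le> snd p)" for y t
  proof -
    have "y + t *\<^sub>R b \<in> S \<longleftrightarrow> (\<forall>p\<in>I. fst p \<bullet> (y + t *\<^sub>R b) \<le> snd p)"
      using I(2) by auto
    moreover have "I = U \<union> L \<union> Z" by (auto simp: U_def L_def Z_def)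
    moreover have "\<forall>p\<in>U. fst p \<bullet> (y + t *\<^sub>R b) \<le> snd p \<longleftrightarrow> t \<le> l y p"
      "\<forall>p\<in>L. fst p \<bullet> (y + t *\<^sub>R b) \<le> snd p \<longleftrightarrow> l y p \<le> t"
      "\<forall>p\<in>Z. fst p \<bullet> (y + t *\<^sub>R b) \<le> snd p \<longleftrightarrow> fst p \<bullet> y \<le> snd p"
      by (simp_all add: halfspace_on_line l_def U_def L_def Z_def)
    ultimately show ?thesis by blast
  qed
  have "(\<exists>t. y + t *\<^sub>R b \<in> S) \<longleftrightarrow> (\<forall>(a,c)\<in>J \<union> Z. a \<bullet> y \<le> c)" for y
  proof -
    have "(\<exists>t. y + t *\<^sub>R b \<in> S) \<longleftrightarrow>
        (\<forall>q\<in>L. \<forall>p\<in>U. l y q \<le> l y p) \<and> (\<forall>p\<in>Z. fst p \<bullet> y \<le> snd p)"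
    proof
      assume "\<exists>t. y + t *\<^sub>R b \<in> S"
      then show "(\<forall>q\<in>L. \<forall>p\<in>U. l y q \<le> l y p) \<and> (\<forall>p\<in>Z. fst p \<bullet> y \<le> snd p)"
        unfolding split by (meson order_trans)
    next
      assume "(\<forall>q\<in>L. \<forall>p\<in>U. l y q \<le> l y p) \<and> (\<forall>p\<in>Z. fst p \<bullet> y \<le> snd p)"
      then show "\<exists>t. y + t *\<^sub>R b \<in> S"
        unfolding split using finite_intervals_meet[of L U "l y" "l y"] fin by blast
    qed
    also have "(\<forall>q\<in>L. \<forall>p\<in>U. l y q \<le> l y p) \<longleftrightarrow> (\<forall>(a,c)\<in>J. a \<bullet> y \<le> c)"
      unfolding J_def l_def
      by (auto simp: inner_diff_left diff_divide_distrib divide_inverse algebra_simps)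
    also have "((\<forall>(a,c)\<in>J. a \<bullet> y \<le> c) \<and> (\<forall>p\<in>Z. fst p \<bullet> y \<le> snd p)) \<longleftrightarrow>
        (\<forall>(a,c)\<in>J \<union> Z. a \<bullet> y \<le> c)"
      by (auto simp: split_beta)
    finally show ?thesis .
  qed
  then have "{y. \<exists>t. y + t *\<^sub>R b \<in> S} = {y. \<forall>(a,c)\<in>J \<union> Z. a \<bullet> y \<le> c}" by blast
  with fin show ?thesis using polyhedron_iff_finite_inequalities finite_UnI by blast
qed

text \<open>A point \<open>y\<close> of the polyhedron shows that the inequalities fail at a nearby \<open>y'\<close> by at most a multiple
  of the distance. If some shift of \<open>y'\<close> along \<open>b\<close> repairs them all, then so does a shift of
  proportional size.\<close>

lemma polyhedron_lipschitz_along_direction: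
  fixes S :: "'a::euclidean_space set"
  assumes "polyhedron S"
  obtains L where "L \<ge> 0"
    "\<And>y y' s. y \<in> S \<Longrightarrow> y' + s *\<^sub>R b \<in> S \<Longrightarrow>
        \<exists>t. y' + t *\<^sub>R b \<in> S \<and> norm (y' + t *\<^sub>R b - y) \<le> L * norm (y' - y)"
proof -
  obtain I where I: "finite I" "S = {y. \<forall>(a,c)\<in>I. a \<bullet> y \<le> c}"
    using assms polyhedron_iff_finite_inequalities by blast
  define k where "k p = norm (fst p) / \<bar>fst p \<bullet> b\<bar>" for p :: "'a \<times> real"
  define M where "M = sum k I"
  have k: "k p \<le> M" if "p \<in> I" for p
    unfolding M_def by (rule member_le_sum) (use that I(1) in \<open>auto simp: k_def\<close>)
  have M: "M \<ge> 0" unfolding M_def by (rule sum_nonneg) (simp add: k_def)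
  show thesis
  proof
    show "1 + M * norm b \<ge> 0" using M by simp
    fix y y' s assume y: "y \<in> S" and y': "y' + s *\<^sub>R b \<in> S"
    define d where "d = norm (y' - y)"
    have near: "\<bar>(a \<bullet> y' - a \<bullet> y) / (a \<bullet> b)\<bar> \<le> M * d" if "(a, c) \<in> I" for a c
    proof -
      have "\<bar>a \<bullet> y' - a \<bullet> y\<bar> \<le> norm a * d"
        unfolding d_def using Cauchy_Schwarz_ineq2[of a "y' - y"] by (simp add: inner_diff_right)
      then have "\<bar>(a \<bullet> y' - a \<bullet> y) / (a \<bullet> b)\<bar> \<le> k (a, c) * d"
        by (simp add: k_def divide_right_mono)
      also have "\<dots> \<le> M * d" using k[OF that] by (intro mult_right_mono) (auto simp: d_def)
      finally show ?thesis .
    qed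
    (* \<open>s\<close> truncated to \<open>[- M d, M d]\<close>: it stays on the feasible side of the bounds that \<open>s\<close> satisfies, and
       by \<open>near\<close> a shift by \<open>M d\<close> in the direction of \<open>s\<close> meets the bounds on the other side. *)
    define t where "t = (if s \<ge> 0 then min s (M * d) else max s (- (M * d)))"
    have Md: "M * d \<ge> 0" using M by (simp add: d_def)
    have "a \<bullet> (y' + t *\<^sub>R b) \<le> c" if ac: "(a, c) \<in> I" for a c
    proof -
      have 1: "a \<bullet> y \<le> c" "a \<bullet> (y' + s *\<^sub>R b) \<le> c" using y y' I(2) ac by auto
      consider "a \<bullet> b > 0" | "a \<bullet> b < 0" | "a \<bullet> b = 0" by linarith
      then show ?thesis
      proof cases
        case 1
        have "s \<le> (c - a \<bullet> y') / (a \<bullet> b)"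
          using halfspace_on_line(1)[OF 1] \<open>a \<bullet> (y' + s *\<^sub>R b) \<le> c\<close> by blast
        moreover have "(a \<bullet> y - a \<bullet> y') / (a \<bullet> b) \<le> (c - a \<bullet> y') / (a \<bullet> b)"
          using 1 \<open>a \<bullet> y \<le> c\<close> by (simp add: divide_right_mono)
        then have "- (M * d) \<le> (c - a \<bullet> y') / (a \<bullet> b)"
          using near[OF ac] by (simp add: diff_divide_distrib abs_le_iff)
        ultimately have "t \<le> (c - a \<bullet> y') / (a \<bullet> b)"
          using Md by (auto simp: t_def)
        then show ?thesis using halfspace_on_line(1)[OF 1] by blast
      next
        case 2
        have "(c - a \<bullet> y') / (a \<bullet> b) \<le> s"
          using halfspace_on_line(2)[OF 2] \<open>a \<bullet> (y' + s *\<^sub>R b) \<le> c\<close> by blast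
        moreover have "(c - a \<bullet> y') / (a \<bullet> b) \<le> (a \<bullet> y - a \<bullet> y') / (a \<bullet> b)"
          using 2 \<open>a \<bullet> y \<le> c\<close> by (simp add: divide_right_mono_neg)
        then have "(c - a \<bullet> y') / (a \<bullet> b) \<le> M * d"
          using near[OF ac] by (simp add: diff_divide_distrib abs_le_iff)
        ultimately have "(c - a \<bullet> y') / (a \<bullet> b) \<le> t"
          using Md by (auto simp: t_def)
        then show ?thesis using halfspace_on_line(2)[OF 2] by blast
      next
        case 3
        then show ?thesis using \<open>a \<bullet> (y' + s *\<^sub>R b) \<le> c\<close> by (simp add: inner_right_distrib)
      qed
    qed
    then have "y' + t *\<^sub>R b \<in> S" using I(2) by auto
    moreover have "\<bar>t\<bar> \<le> M * d" using Md by (auto simp: t_def)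
    then have "norm (y' + t *\<^sub>R b - y) \<le> d + M * d * norm b"
      using norm_triangle_ineq[of "y' - y" "t *\<^sub>R b"] mult_right_mono[of "\<bar>t\<bar>" "M * d" "norm b"]
      by (simp add: d_def algebra_simps)
    then have "norm (y' + t *\<^sub>R b - y) \<le> (1 + M * norm b) * norm (y' - y)"
      by (simp add: d_def algebra_simps)
    ultimately show "\<exists>t. y' + t *\<^sub>R b \<in> S \<and>
        norm (y' + t *\<^sub>R b - y) \<le> (1 + M * norm b) * norm (y' - y)" by blast
  qed
qed

text \<open>Directions are eliminated one after the other: the eliminated set is again a polyhedron, and the
  Lipschitz constants multiply.\<close>

lemma polyhedron_eliminate_span:
  fixes S :: "'a::euclidean_space set"
  assumes "finite D" "polyhedron S"
  shows "polyhedron {y. \<exists>w\<in>span D. y + w \<in> S} \<and>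
    (\<exists>L\<ge>0. \<forall>y\<in>S. \<forall>y'. (\<exists>w\<in>span D. y' + w \<in> S) \<longrightarrow>
        (\<exists>w\<in>span D. y' + w \<in> S \<and> norm (y' + w - y) \<le> L * norm (y' - y)))"
  using assms(1)
proof (induction rule: finite_induct)
  case empty
  show ?case using assms(2) by (auto intro!: exI[of _ 1])
next
  case (insert b D)
  define S1 where "S1 = {y. \<exists>w\<in>span D. y + w \<in> S}"
  from insert.IH obtain L where S1: "polyhedron S1" and L: "L \<ge> 0"
    "\<And>y y'. y \<in> S \<Longrightarrow> y' \<in> S1 \<Longrightarrow>
        \<exists>w\<in>span D. y' + w \<in> S \<and> norm (y' + w - y) \<le> L * norm (y' - y)"
    unfolding S1_def by blast
  obtain L1 where L1: "L1 \<ge> 0"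
    "\<And>y y' s. y \<in> S1 \<Longrightarrow> y' + s *\<^sub>R b \<in> S1 \<Longrightarrow>
        \<exists>t. y' + t *\<^sub>R b \<in> S1 \<and> norm (y' + t *\<^sub>R b - y) \<le> L1 * norm (y' - y)"
    using polyhedron_lipschitz_along_direction[OF S1, of b] by metis
  have span: "w \<in> span (insert b D) \<longleftrightarrow> (\<exists>t. \<exists>w'\<in>span D. w = t *\<^sub>R b + w')" for w
  proof
    assume "w \<in> span (insert b D)"
    then obtain t where "w - t *\<^sub>R b \<in> span D" unfolding span_insert by blast
    then show "\<exists>t. \<exists>w'\<in>span D. w = t *\<^sub>R b + w'"
      by (intro exI[of _ t] bexI[of _ "w - t *\<^sub>R b"]) auto
  next
    assume "\<exists>t. \<exists>w'\<in>span D. w = t *\<^sub>R b + w'"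
    then obtain t w' where "w' \<in> span D" "w = t *\<^sub>R b + w'" by blast
    then have "w - t *\<^sub>R b \<in> span D" by simp
    then show "w \<in> span (insert b D)" unfolding span_insert by blast
  qed
  have eq: "(\<exists>w\<in>span (insert b D). y + w \<in> S) \<longleftrightarrow> (\<exists>t. y + t *\<^sub>R b \<in> S1)" for y
  proof
    assume "\<exists>w\<in>span (insert b D). y + w \<in> S"
    then obtain t w' where "w' \<in> span D" "y + (t *\<^sub>R b + w') \<in> S"
      unfolding Bex_def span by blast
    then have "y + t *\<^sub>R b \<in> S1" unfolding S1_def mem_Collect_eq add.assoc by blast
    then show "\<exists>t. y + t *\<^sub>R b \<in> S1" ..
  next
    assume "\<exists>t. y + t *\<^sub>R b \<in> S1"
    then obtain t w where "w \<in> span D" "y + (t *\<^sub>R b + w) \<in> S"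
      unfolding S1_def mem_Collect_eq add.assoc by blast
    moreover from this(1) have "t *\<^sub>R b + w \<in> span (insert b D)" unfolding span by blast
    ultimately show "\<exists>w\<in>span (insert b D). y + w \<in> S" by blast
  qed
  have "polyhedron {y. \<exists>w\<in>span (insert b D). y + w \<in> S}"
    unfolding eq by (rule polyhedron_eliminate_direction[OF S1])
  moreover have "\<exists>w\<in>span (insert b D). y' + w \<in> S \<and> norm (y' + w - y) \<le> (L * L1) * norm (y' - y)"
    if y: "y \<in> S" and y': "\<exists>w\<in>span (insert b D). y' + w \<in> S" for y y'
  proof -
    have "y \<in> S1" unfolding S1_def using y span_zero by force
    with y' obtain t where t: "y' + t *\<^sub>R b \<in> S1"
        "norm (y' + t *\<^sub>R b - y) \<le> L1 * norm (y' - y)"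
      unfolding eq using L1(2) by blast
    obtain w where w: "w \<in> span D" "y' + t *\<^sub>R b + w \<in> S"
        "norm (y' + t *\<^sub>R b + w - y) \<le> L * norm (y' + t *\<^sub>R b - y)"
      using L(2)[OF y t(1)] by blast
    have "norm (y' + t *\<^sub>R b + w - y) \<le> L * (L1 * norm (y' - y))"
      using w(3) t(2) L(1) by (meson mult_left_mono order_trans)
    moreover have "t *\<^sub>R b + w \<in> span (insert b D)" unfolding span using w(1) by blast
    ultimately show ?thesis using w(2) unfolding add.assoc mult.assoc by blast
  qed
  moreover have "0 \<le> L * L1" using L(1) L1(1) by simp
  ultimately show ?case by blast
qed

text \<open>Projections onto a factor arise by eliminating the basis directions of the other factor.\<close>

proposition polyhedron_projection_lipschitz:
  fixes S :: "('a::euclidean_space \<times> 'b::euclidean_space) set"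
  assumes "polyhedron S"
  shows "polyhedron (fst ` S)"
    and "\<exists>L\<ge>0. \<forall>p u p'. (p, u) \<in> S \<and> p' \<in> fst ` S \<longrightarrow>
            (\<exists>u'. (p', u') \<in> S \<and> norm (u' - u) \<le> L * norm (p' - p))"
proof -
  define D :: "('a \<times> 'b) set" where "D = Pair 0 ` Basis"
  have span: "span D = Pair 0 ` UNIV"
  proof -
    have "linear (Pair (0::'a) :: 'b \<Rightarrow> 'a \<times> 'b)" by (rule linearI) auto
    then show ?thesis unfolding D_def by (simp add: linear_span_image)
  qed
  have "finite D" by (simp add: D_def)
  from polyhedron_eliminate_span[OF this assms] obtain L where
    poly: "polyhedron {y. \<exists>w\<in>span D. y + w \<in> S}" and L: "L \<ge> 0"
    "\<And>y y'. y \<in> S \<Longrightarrow> \<exists>w\<in>span D. y' + w \<in> S \<Longrightarrow>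
        \<exists>w\<in>span D. y' + w \<in> S \<and> norm (y' + w - y) \<le> L * norm (y' - y)"
    by blast
  have "linear (\<lambda>p::'a. (p, 0::'b))" by (rule linearI) auto
  from polyhedron_linear_preimage[OF this poly]
  have "polyhedron {p. \<exists>u. (p, u) \<in> S}" by (simp add: span)
  moreover have "{p. \<exists>u. (p, u) \<in> S} = fst ` S" by force
  ultimately show "polyhedron (fst ` S)" by simp
  have "\<exists>u'. (p', u') \<in> S \<and> norm (u' - u) \<le> L * norm (p' - p)"
    if pu: "(p, u) \<in> S" and p': "p' \<in> fst ` S" for p u p'
  proof -
    obtain u1 where "(p', u1) \<in> S" using p' by auto
    then have "\<exists>w\<in>span D. (p', u) + w \<in> S"
      by (auto simp: span intro!: exI[of _ "u1 - u"])
    from L(2)[OF pu this] obtain w where w: "(p', u + w) \<in> S"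
        "norm ((p', u + w) - (p, u)) \<le> L * norm ((p', u) - (p, u))"
      by (auto simp: span)
    have "norm (u + w - u) \<le> norm ((p', u + w) - (p, u))"
      using norm_snd_le[of "u + w - u" "p' - p"] by simp
    also have "\<dots> \<le> L * norm (p' - p)" using w(2) by (simp add: norm_Pair)
    finally show ?thesis using w(1) by blast
  qed
  with L(1) show "\<exists>L\<ge>0. \<forall>p u p'. (p, u) \<in> S \<and> p' \<in> fst ` S \<longrightarrow>
      (\<exists>u'. (p', u') \<in> S \<and> norm (u' - u) \<le> L * norm (p' - p))" by blast
qed

section \<open>Weighted seminorms and observability\<close>

lemma sym_pd_imp_psd: "sym_pd M \<Longrightarrow> sym_psd M"
  unfolding sym_pd_def sym_psd_def by (metis inner_zero_left less_eq_real_def)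

lemma sym_psd_swap: "sym_psd M \<Longrightarrow> x \<bullet> (M *v y) = (M *v x) \<bullet> y"
  unfolding sym_psd_def by (metis dot_lmul_matrix vector_transpose_matrix)

lemma wnorm_nonneg [simp]: "sym_psd M \<Longrightarrow> 0 \<le> wnorm M x"
  by (simp add: wnorm_def sym_psd_def)

lemma wnorm_zero [simp]: "wnorm M 0 = 0"
  by (simp add: wnorm_def)

lemma wnorm_sq: "sym_psd M \<Longrightarrow> (wnorm M x)\<^sup>2 = x \<bullet> (M *v x)"
  by (simp add: wnorm_def sym_psd_def)

lemma wnorm_sq_add:
  assumes "sym_psd M"
  shows "(wnorm M (x + y))\<^sup>2 = (wnorm M x)\<^sup>2 + 2 * (x \<bullet> (M *v y)) + (wnorm M y)\<^sup>2"
  using sym_psd_swap[OF assms, of y x]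
  by (simp add: wnorm_sq[OF assms] matrix_vector_right_distrib inner_add_left inner_add_right
      inner_commute)

lemma wnorm_scaleR: "sym_psd M \<Longrightarrow> wnorm M (t *\<^sub>R x) = \<bar>t\<bar> * wnorm M x"
  by (simp add: wnorm_def matrix_vector_mult_scaleR real_sqrt_mult flip: mult.assoc)

text \<open>The quadratic \<open>t \<mapsto> \<parallel>x + t y\<parallel>\<^sub>M\<^sup>2\<close> is nonnegative. For degenerate \<open>y\<close> it is affine in \<open>t\<close>, which is why
  that case is separate.\<close>

lemma wnorm_Cauchy_Schwarz:
  assumes "sym_psd M"
  shows "x \<bullet> (M *v y) \<le> wnorm M x * wnorm M y"
proof (cases "wnorm M y = 0")
  case True
  have "x \<bullet> (M *v y) \<le> 0"
  proof (rule ccontr)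
    define b where "b = x \<bullet> (M *v y)"
    assume "\<not> x \<bullet> (M *v y) \<le> 0"
    then have b: "b > 0" by (simp add: b_def)
    (* This \<open>t\<close> makes the affine function equal to \<open>- 1\<close>. *)
    define t where "t = - ((wnorm M x)\<^sup>2 + 1) / (2 * b)"
    have "(wnorm M (x + t *\<^sub>R y))\<^sup>2 = (wnorm M x)\<^sup>2 + 2 * t * b"
      using True by (simp add: wnorm_sq_add[OF assms] wnorm_scaleR[OF assms] b_def
          matrix_vector_mult_scaleR)
    also have "\<dots> = - 1" using b by (simp add: t_def field_simps)
    finally show False by (metis zero_le_power2 not_one_le_zero neg_0_le_iff_le)
  qed
  with True show ?thesis by simp
next
  case False
  define a where "a = wnorm M x"
  define b where "b = x \<bullet> (M *v y)"
  define c where "c = wnorm M y"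
  have c: "c > 0" and a: "a \<ge> 0"
    using False wnorm_nonneg[OF assms] by (simp_all add: c_def a_def less_le)
  define t where "t = - b / c\<^sup>2"
  have "0 \<le> (wnorm M (x + t *\<^sub>R y))\<^sup>2" by simp
  also have "\<dots> = a\<^sup>2 + 2 * t * b + t\<^sup>2 * c\<^sup>2"
    by (simp add: wnorm_sq_add[OF assms] wnorm_scaleR[OF assms] a_def b_def c_def
        matrix_vector_mult_scaleR power_mult_distrib)
  also have "\<dots> = a\<^sup>2 - b\<^sup>2 / c\<^sup>2"
    using c by (simp add: t_def field_simps power2_eq_square)
  finally have "b\<^sup>2 \<le> (a * c)\<^sup>2"
    using c by (simp add: field_simps power_mult_distrib)
  then have "b \<le> a * c" using a c by (meson abs_ge_self abs_le_square_iff order_trans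
      power2_le_imp_le mult_nonneg_nonneg less_imp_le)
  then show ?thesis by (simp add: a_def b_def c_def)
qed

lemma wnorm_triangle:
  assumes "sym_psd M"
  shows "wnorm M (x + y) \<le> wnorm M x + wnorm M y"
proof (rule power2_le_imp_le)
  show "(wnorm M (x + y))\<^sup>2 \<le> (wnorm M x + wnorm M y)\<^sup>2"
    using wnorm_Cauchy_Schwarz[OF assms, of x y] by (simp add: wnorm_sq_add[OF assms] power2_sum)
qed (use assms in simp)

lemma wnorm_le_norm:
  assumes "sym_psd M"
  obtains c where "c \<ge> 0" "\<And>x. wnorm M x \<le> c * norm x"
proof
  define c where "c = onorm ((*v) M)"
  have c: "c \<ge> 0" unfolding c_def by (simp add: onorm_pos_le)
  then show "sqrt c \<ge> 0" by simp
  fix x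
  have "x \<bullet> (M *v x) \<le> norm x * norm (M *v x)" by (rule norm_cauchy_schwarz)
  also have "\<dots> \<le> norm x * (c * norm x)"
    unfolding c_def by (intro mult_left_mono onorm) auto
  finally have "x \<bullet> (M *v x) \<le> c * (norm x)\<^sup>2" by (simp add: power2_eq_square algebra_simps)
  then have "wnorm M x \<le> sqrt (c * (norm x)\<^sup>2)"
    unfolding wnorm_def by (rule real_sqrt_le_mono)
  then show "wnorm M x \<le> sqrt c * norm x" by (simp add: real_sqrt_mult)
qed

text \<open>For merely semidefinite \<open>M\<close> the seminorm does not control \<open>x\<close>, but it controls \<open>M x\<close>, which is what
  observability uses: apply Cauchy-Schwarz to \<open>x\<close> and \<open>M x\<close>.\<close>

lemma norm_mult_le_wnorm:
  assumes "sym_psd M"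
  obtains c where "c \<ge> 0" "\<And>x. norm (M *v x) \<le> c * wnorm M x"
proof -
  obtain c where c: "c \<ge> 0" "\<And>x. wnorm M x \<le> c * norm x"
    using wnorm_le_norm[OF assms] by metis
  have "norm (M *v x) \<le> c * wnorm M x" for x
  proof (cases "M *v x = 0")
    case False
    have "norm (M *v x) * norm (M *v x) = x \<bullet> (M *v (M *v x))"
      using sym_psd_swap[OF assms, of x "M *v x"]
      by (simp add: dot_square_norm power2_eq_square)
    also have "\<dots> \<le> wnorm M x * wnorm M (M *v x)" by (rule wnorm_Cauchy_Schwarz[OF assms])
    also have "\<dots> \<le> wnorm M x * (c * norm (M *v x))"
      by (intro mult_left_mono c wnorm_nonneg assms)
    finally have "norm (M *v x) * norm (M *v x) \<le> (c * wnorm M x) * norm (M *v x)"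
      by (simp add: algebra_simps)
    then show ?thesis using False mult_le_cancel_right_pos[of "norm (M *v x)"] by simp
  qed (use c(1) assms in simp)
  then show thesis using that c(1) by blast
qed

lemma norm_le_wnorm:
  assumes "sym_pd M"
  obtains c where "c \<ge> 0" "\<And>x. norm x \<le> c * wnorm M x"
proof -
  obtain c where c: "c \<ge> 0" "\<And>x. norm (M *v x) \<le> c * wnorm M x"
    using norm_mult_le_wnorm[OF sym_pd_imp_psd[OF assms]] by metis
  have "inj ((*v) M)"
  proof (rule injI)
    fix x y assume "M *v x = M *v y"
    then have "(x - y) \<bullet> (M *v (x - y)) = 0" by (simp add: matrix_vector_mult_diff_distrib)
    then show "x = y" using assms unfolding sym_pd_def by (metis less_irrefl right_minus_eq)
  qed
  then obtain b where b: "b > 0" "\<And>x. norm x * b \<le> norm (M *v x)"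
    using linear_inj_bounded_below_pos[of "(*v) M"] by (auto simp: mult.commute)
  have "norm x \<le> (c / b) * wnorm M x" for x
    using b(1) order_trans[OF b(2) c(2)[of x]] by (simp add: field_simps)
  then show thesis using that[of "c / b"] b(1) c(1) by simp
qed

text \<open>Observability sees every nonzero state at some time. By compactness of the unit sphere finitely many
  times suffice, and the largest output over them is bounded below on the sphere, hence everywhere by
  homogeneity.\<close>

lemma observable_finite_horizon:
  fixes A :: "real^'n^'n" and H :: "real^'n^'p"
  assumes "observable A H"
  obtains n m where "m > 0" "\<And>x. \<exists>k<n. m * norm x \<le> norm (H *v (((*v) A ^^ k) x))"
proof -
  define h where "h k x = H *v (((*v) A ^^ k) x)" for k x
  have lin: "linear ((*v) A ^^ k)" for k
    by (induction k) (simp_all only: funpow.simps linear_id matrix_vector_mul_linear linear_compose)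
  have linh: "linear (h k)" for k
    unfolding h_def using linear_compose[OF lin matrix_vector_mul_linear[of H]] by (simp add: o_def)
  have cont: "continuous_on S (h k)" for S k by (intro linear_continuous_on linear_linear[THEN iffD2] linh)
  have nz: "\<exists>k. h k x \<noteq> 0" if "x \<noteq> 0" for x
  proof (rule ccontr)
    assume "\<nexists>k. h k x \<noteq> 0"
    then have "\<forall>k. h k x = h k 0" using linear_0[OF linh] by simp
    with assms that show False unfolding observable_def h_def by blast
  qed
  have "sphere 0 1 \<subseteq> (\<Union>k. {x. h k x \<noteq> 0})"
  proof
    fix x :: "real^'n" assume "x \<in> sphere 0 1"
    then have "x \<noteq> 0" by auto
    then show "x \<in> (\<Union>k. {x. h k x \<noteq> 0})" using nz by blast
  qed
  moreover have "open {x. h k x \<noteq> 0}" for k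
    using open_Collect_neq[OF cont[of UNIV] continuous_on_const] by simp
  ultimately obtain I where I: "finite I" "sphere 0 1 \<subseteq> (\<Union>k\<in>I. {x. h k x \<noteq> 0})"
    using compactE_image[OF compact_sphere, of UNIV "\<lambda>k. {x. h k x \<noteq> 0}"] by metis
  define s where "s x = (\<Sum>k\<in>I. norm (h k x))" for x
  have "sphere (0::real^'n) 1 \<noteq> {}" by simp
  moreover have "continuous_on (sphere 0 1) s"
    unfolding s_def by (intro continuous_intros cont)
  ultimately obtain z where z: "z \<in> sphere 0 1" "\<And>x. x \<in> sphere 0 1 \<Longrightarrow> s z \<le> s x"
    using continuous_attains_inf[OF compact_sphere] by metis
  obtain k0 where k0: "k0 \<in> I" "h k0 z \<noteq> 0" using I(2) z(1) by blast
  have sz: "s z > 0"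
    unfolding s_def by (rule sum_pos2[OF I(1) k0(1)]) (use k0 in auto)
  (* The largest of the outputs is at least their mean. *)
  define m where "m = s z / real (card I)"
  have cI: "card I > 0" using k0 I(1) by (auto simp: card_gt_0_iff)
  have "\<exists>k<Suc (Max I). m * norm x \<le> norm (h k x)" for x
  proof (cases "x = 0")
    case False
    define y where "y = x /\<^sub>R norm x"
    have y: "y \<in> sphere 0 1" using False by (simp add: y_def)
    have "\<exists>k\<in>I. m \<le> norm (h k y)"
    proof (rule ccontr)
      assume "\<not> (\<exists>k\<in>I. m \<le> norm (h k y))"
      then have "s y < (\<Sum>k\<in>I. m)"
        unfolding s_def using I(1) k0(1) by (intro sum_strict_mono) auto
      also have "\<dots> = s z" using cI by (simp add: m_def)
      finally show False using z(2)[OF y] by simp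
    qed
    then obtain k where k: "k \<in> I" "m \<le> norm (h k y)" by blast
    have "norm (h k x) = norm x * norm (h k y)"
      using False by (simp add: y_def linear_scale[OF linh])
    then have "m * norm x \<le> norm (h k x)" 
      using mult_left_mono[OF k(2), of "norm x"] by (simp add: mult.commute)
    moreover have "k < Suc (Max I)" using k(1) I(1) by (simp add: le_imp_less_Suc)
    ultimately show ?thesis by blast
  qed auto
  moreover have "m > 0" using sz cI by (simp add: m_def)
  ultimately show thesis using that unfolding h_def by blast
qed

text \<open>The constant depends on the time \<open>k\<close> only, by the variation-of-constants recursion.\<close>

lemma perturbed_trajectory_bound:
  fixes A :: "real^'n^'n" and B :: "real^'m^'n"
  shows "\<exists>c\<ge>0. \<forall>\<delta> w s. (\<forall>i<k. \<delta> (Suc i) = A *v \<delta> i + B *v w i \<and> norm (w i) \<le> s) \<longrightarrow>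
           norm (\<delta> k - ((*v) A ^^ k) (\<delta> 0)) \<le> c * s"
proof (induction k)
  case (Suc k)
  then obtain c where c: "c \<ge> 0" "\<And>\<delta> w s. \<forall>i<k. \<delta> (Suc i) = A *v \<delta> i + B *v w i \<and> norm (w i) \<le> s \<Longrightarrow>
           norm (\<delta> k - ((*v) A ^^ k) (\<delta> 0)) \<le> c * s" by blast
  define a where "a = onorm ((*v) A)"
  define b where "b = onorm ((*v) B)"
  have ab: "a \<ge> 0" "b \<ge> 0" by (simp_all add: a_def b_def onorm_pos_le)
  have "norm (\<delta> (Suc k) - ((*v) A ^^ Suc k) (\<delta> 0)) \<le> (a * c + b) * s"
    if *: "\<forall>i<Suc k. \<delta> (Suc i) = A *v \<delta> i + B *v w i \<and> norm (w i) \<le> s" for \<delta> w s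
  proof -
    have 1: "norm (\<delta> k - ((*v) A ^^ k) (\<delta> 0)) \<le> c * s" using c(2)[of \<delta> w s] * by simp
    have "\<delta> (Suc k) - ((*v) A ^^ Suc k) (\<delta> 0) = A *v (\<delta> k - ((*v) A ^^ k) (\<delta> 0)) + B *v w k"
      using * by (simp add: matrix_vector_mult_diff_distrib)
    also have "norm \<dots> \<le> a * norm (\<delta> k - ((*v) A ^^ k) (\<delta> 0)) + b * norm (w k)"
      unfolding a_def b_def by (intro norm_triangle_mono onorm) auto
    also have "\<dots> \<le> a * (c * s) + b * s"
      using 1 * ab by (intro add_mono mult_left_mono) auto
    finally show ?thesis by (simp add: algebra_simps)
  qed
  moreover have "a * c + b \<ge> 0" using ab c by simp
  ultimately show ?case by blast
qed (auto intro: exI[of _ 0])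

text \<open>Quantitative observability: outputs and inputs bounded by \<open>s\<close> on a long enough window differ from an
  unforced trajectory by \<open>O(s)\<close>, and the unforced trajectory reveals the initial state.\<close>

proposition observability_estimate:
  fixes A :: "real^'n^'n" and B :: "real^'m^'n" and H :: "real^'n^'p"
  assumes "observable A H"
  obtains n M where "M \<ge> 0"
    "\<And>\<delta> w s. (\<And>k. k < n \<Longrightarrow> \<delta> (Suc k) = A *v \<delta> k + B *v w k) \<Longrightarrow>
        (\<And>k. k < n \<Longrightarrow> norm (H *v \<delta> k) \<le> s) \<Longrightarrow> (\<And>k. k < n \<Longrightarrow> norm (w k) \<le> s) \<Longrightarrow>
        norm (\<delta> 0) \<le> M * s"
proof -
  obtain n m where m: "m > 0" and nm: "\<And>x. \<exists>k<n. m * norm x \<le> norm (H *v (((*v) A ^^ k) x))"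
    using observable_finite_horizon[OF assms] by metis
  obtain c where c: "\<And>k. c k \<ge> 0" "\<And>k \<delta> w s. \<forall>i<k. \<delta> (Suc i) = A *v \<delta> i + B *v w i \<and> norm (w i) \<le> s \<Longrightarrow>
           norm (\<delta> k - ((*v) A ^^ k) (\<delta> 0)) \<le> c k * s"
    using perturbed_trajectory_bound[of _ A B] by metis
  define h where "h = onorm ((*v) H)"
  have h: "h \<ge> 0" by (simp add: h_def onorm_pos_le)
  define C where "C = sum c {..<n}"
  have C: "C \<ge> 0" by (simp add: C_def c sum_nonneg)
  show thesis
  proof
    show "(1 + h * C) / m \<ge> 0" using h C m by simp
    fix \<delta> :: "nat \<Rightarrow> real^'n" and w :: "nat \<Rightarrow> real^'m" and s :: real
    assume 1: "\<And>k. k < n \<Longrightarrow> \<delta> (Suc k) = A *v \<delta> k + B *v w k"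
      and 2: "\<And>k. k < n \<Longrightarrow> norm (H *v \<delta> k) \<le> s" and 3: "\<And>k. k < n \<Longrightarrow> norm (w k) \<le> s"
    obtain k where k: "k < n" "m * norm (\<delta> 0) \<le> norm (H *v (((*v) A ^^ k) (\<delta> 0)))"
      using nm by blast
    have s: "s \<ge> 0" using 2[OF k(1)] norm_ge_zero order_trans by blast
    have "norm (\<delta> k - ((*v) A ^^ k) (\<delta> 0)) \<le> c k * s"
      using c(2)[of k \<delta> w s] 1 3 k(1) by simp
    also have "\<dots> \<le> C * s"
      unfolding C_def using s k(1) c(1) by (intro mult_right_mono member_le_sum) auto
    finally have d: "norm (\<delta> k - ((*v) A ^^ k) (\<delta> 0)) \<le> C * s" .
    have "H *v (((*v) A ^^ k) (\<delta> 0)) = H *v \<delta> k - H *v (\<delta> k - ((*v) A ^^ k) (\<delta> 0))"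
      by (simp add: matrix_vector_mult_diff_distrib)
    also have "norm \<dots> \<le> norm (H *v \<delta> k) + norm (H *v (\<delta> k - ((*v) A ^^ k) (\<delta> 0)))"
      by (rule norm_triangle_ineq4)
    also have "\<dots> \<le> s + h * (C * s)"
    proof (rule add_mono[OF 2[OF k(1)]])
      have "norm (H *v (\<delta> k - ((*v) A ^^ k) (\<delta> 0))) \<le> h * norm (\<delta> k - ((*v) A ^^ k) (\<delta> 0))"
        unfolding h_def by (rule onorm) simp
      also have "\<dots> \<le> h * (C * s)" by (rule mult_left_mono[OF d h])
      finally show "norm (H *v (\<delta> k - ((*v) A ^^ k) (\<delta> 0))) \<le> h * (C * s)" .
    qed
    finally have "m * norm (\<delta> 0) \<le> (1 + h * C) * s" using k(2) by (simp add: algebra_simps)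
    then show "norm (\<delta> 0) \<le> (1 + h * C) / m * s" using m by (simp add: field_simps)
  qed
qed

section \<open>Feasible input sequences\<close>

lemma pred_state_Suc_shift:
  "pred_state A B x \<mu> (Suc i) = pred_state A B (A *v x + B *v \<mu> 0) (\<lambda>j. \<mu> (Suc j)) i"
  by (induction i) simp_all

lemma pred_state_cong:
  "(\<And>j. j < i \<Longrightarrow> \<mu> j = \<mu>' j) \<Longrightarrow> pred_state A B x \<mu> i = pred_state A B x \<mu>' i"
  by (induction i) simp_all

lemma ocp_feasible_Suc:
  "ocp_feasible A B C D Y T (Suc n) x v \<mu> \<longleftrightarrow>
     C *v x + D *v \<mu> 0 \<in> Y \<and> ocp_feasible A B C D Y T n (A *v x + B *v \<mu> 0) v (\<lambda>j. \<mu> (Suc j))"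
  unfolding ocp_feasible_def
  by (simp add: All_less_Suc2 pred_state_Suc_shift del: pred_state.simps(2))

lemma ocp_params_0: "ocp_params A B C D Y T 0 = T"
  by (auto simp: ocp_params_def ocp_feasible_def)

text \<open>Dynamic programming for feasibility: one more stage is a single projection that eliminates one
  input. This allows induction on the horizon although the horizon is not part of any type.\<close>

lemma ocp_params_Suc:
  "ocp_params A B C D Y T (Suc n) =
     fst ` {((x, v), u). C *v x + D *v u \<in> Y \<and> (A *v x + B *v u, v) \<in> ocp_params A B C D Y T n}"
proof -
  have step: "(\<exists>\<mu>. ocp_feasible A B C D Y T (Suc n) x v \<mu>) \<longleftrightarrow>
      (\<exists>u. C *v x + D *v u \<in> Y \<and> (\<exists>\<mu>. ocp_feasible A B C D Y T n (A *v x + B *v u) v \<mu>))"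
    for x v
  proof
    assume "\<exists>u. C *v x + D *v u \<in> Y \<and> (\<exists>\<mu>. ocp_feasible A B C D Y T n (A *v x + B *v u) v \<mu>)"
    then obtain u \<mu> where "C *v x + D *v u \<in> Y" "ocp_feasible A B C D Y T n (A *v x + B *v u) v \<mu>"
      by blast
    then have "ocp_feasible A B C D Y T (Suc n) x v (case_nat u \<mu>)"
      by (simp add: ocp_feasible_Suc)
    then show "\<exists>\<mu>. ocp_feasible A B C D Y T (Suc n) x v \<mu>" by (rule exI[of _ "case_nat u \<mu>"])
  qed (auto simp: ocp_feasible_Suc)
  have fst_image: "fst ` {((x, v), u). q x v u} = {(x, v). \<exists>u. q x v u}" for q :: "_ \<Rightarrow> _ \<Rightarrow> _ \<Rightarrow> bool"
    by force
  show ?thesis unfolding ocp_params_def by (simp add: step fst_image)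
qed

lemma one_step_polyhedron:
  fixes A :: "real^'nx^'nx" and B :: "real^'nu^'nx" and C :: "real^'nx^'ny" and D :: "real^'nu^'ny"
    and G :: "((real^'nx) \<times> (real^'nv)) set"
  assumes "polyhedron Y" "polyhedron G"
  shows "polyhedron {((x, v), u). C *v x + D *v u \<in> Y \<and> (A *v x + B *v u, v) \<in> G}"
proof -
  let ?g = "\<lambda>p :: ((real^'nx) \<times> (real^'nv)) \<times> (real^'nu). C *v fst (fst p) + D *v snd p"
  let ?h = "\<lambda>p :: ((real^'nx) \<times> (real^'nv)) \<times> (real^'nu).
    (A *v fst (fst p) + B *v snd p, snd (fst p))"
  have "linear ?g" "linear ?h"
    by (auto intro!: linearI simp: matrix_vector_right_distrib matrix_vector_mult_scaleR algebra_simps)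
  then have "polyhedron ({p. ?g p \<in> Y} \<inter> {p. ?h p \<in> G})"
    using assms by (intro polyhedron_Int polyhedron_linear_preimage)
  moreover have "{p. ?g p \<in> Y} \<inter> {p. ?h p \<in> G} =
      {((x, v), u). C *v x + D *v u \<in> Y \<and> (A *v x + B *v u, v) \<in> G}" by auto
  ultimately show ?thesis by simp
qed

lemma ocp_params_polyhedron:
  assumes "polyhedron Y" "polyhedron T"
  shows "polyhedron (ocp_params A B C D Y T n)"
proof (induction n)
  case (Suc n)
  then show ?case
    unfolding ocp_params_Suc
    by (intro polyhedron_projection_lipschitz(1) one_step_polyhedron assms)
qed (simp add: ocp_params_0 assms)

text \<open>Choose the first input by the Lipschitz selection for one projection; the successor states then
  differ proportionally, and the remaining inputs come from the induction hypothesis.\<close>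

proposition ocp_feasible_lipschitz:
  fixes A :: "real^'nx^'nx" and B :: "real^'nu^'nx" and C :: "real^'nx^'ny" and D :: "real^'nu^'ny"
    and T :: "((real^'nx) \<times> (real^'nv)) set"
  assumes "polyhedron Y" "polyhedron T"
  shows "\<exists>L\<ge>0. \<forall>x v \<mu> x' v'.
    ocp_feasible A B C D Y T n x v \<mu> \<and> (x', v') \<in> ocp_params A B C D Y T n \<longrightarrow>
    (\<exists>\<mu>'. ocp_feasible A B C D Y T n x' v' \<mu>' \<and>
       (\<forall>i<n. norm (\<mu>' i - \<mu> i) \<le> L * norm ((x', v') - (x, v))) \<and>
       (\<forall>i\<le>n. norm (pred_state A B x' \<mu>' i - pred_state A B x \<mu> i) \<le> L * norm ((x', v') - (x, v))))"
proof (induction n)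
  case 0
  have "norm (x' - x) \<le> norm ((x', v') - (x, v))" for x' x :: "real^'nx" and v' v :: "real^'nv"
    using norm_fst_le[of "x' - x" "v' - v"] by simp
  then show ?case by (auto simp: ocp_params_def ocp_feasible_def intro!: exI[of _ 1])
next
  case (Suc n)
  let ?G = "ocp_params A B C D Y T n"
  let ?S = "{((x, v), u). C *v x + D *v u \<in> Y \<and> (A *v x + B *v u, v) \<in> ?G}"
  from Suc obtain L where L: "L \<ge> 0"
    "\<And>x v \<mu> x' v'. ocp_feasible A B C D Y T n x v \<mu> \<Longrightarrow> (x', v') \<in> ?G \<Longrightarrow>
    \<exists>\<mu>'. ocp_feasible A B C D Y T n x' v' \<mu>' \<and>
       (\<forall>i<n. norm (\<mu>' i - \<mu> i) \<le> L * norm ((x', v') - (x, v))) \<and>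
       (\<forall>i\<le>n. norm (pred_state A B x' \<mu>' i - pred_state A B x \<mu> i) \<le> L * norm ((x', v') - (x, v)))"
    by blast
  define S where "S = ?S"
  have "polyhedron S" unfolding S_def by (intro one_step_polyhedron assms ocp_params_polyhedron)
  moreover have fst_S: "ocp_params A B C D Y T (Suc n) = fst ` S"
    unfolding S_def by (rule ocp_params_Suc)
  ultimately obtain L1 where L1: "L1 \<ge> 0"
    "\<And>p u p'. (p, u) \<in> S \<Longrightarrow> p' \<in> ocp_params A B C D Y T (Suc n) \<Longrightarrow>
        \<exists>u'. (p', u') \<in> S \<and> norm (u' - u) \<le> L1 * norm (p' - p)"
    using polyhedron_projection_lipschitz(2)[of S] unfolding fst_S by blast
  define a where "a = onorm ((*v) A)"
  define b where "b = onorm ((*v) B)"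
  have ab: "a \<ge> 0" "b \<ge> 0" by (simp_all add: a_def b_def onorm_pos_le)
  define L2 where "L2 = 1 + L1 + L * (a + b * L1 + 1)"
  have L2: "L2 \<ge> 1" "L2 \<ge> L1" "L2 \<ge> L * (a + b * L1 + 1)"
    using L1(1) L(1) ab by (simp_all add: L2_def)
  have "\<exists>\<mu>'. ocp_feasible A B C D Y T (Suc n) x' v' \<mu>' \<and>
       (\<forall>i<Suc n. norm (\<mu>' i - \<mu> i) \<le> L2 * norm ((x', v') - (x, v))) \<and>
       (\<forall>i\<le>Suc n. norm (pred_state A B x' \<mu>' i - pred_state A B x \<mu> i) \<le> L2 * norm ((x', v') - (x, v)))"
    if feas: "ocp_feasible A B C D Y T (Suc n) x v \<mu>"
      and mem: "(x', v') \<in> ocp_params A B C D Y T (Suc n)" for x v \<mu> x' v'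
  proof -
    define d where "d = norm ((x', v') - (x, v))"
    have dx: "norm (x' - x) \<le> d" and dv: "norm (v' - v) \<le> d"
      unfolding d_def using norm_fst_le[of "x' - x" "v' - v"] norm_snd_le[of "v' - v" "x' - x"] by auto
    have d0: "d \<ge> 0" by (simp add: d_def)
    define y where "y = A *v x + B *v \<mu> 0"
    have y: "ocp_feasible A B C D Y T n y v (\<lambda>j. \<mu> (Suc j))"
      using feas by (simp add: ocp_feasible_Suc y_def)
    have "((x, v), \<mu> 0) \<in> S" unfolding S_def using feas y by (auto simp: ocp_feasible_Suc y_def ocp_params_def)
    from L1(2)[OF this mem] obtain u' where u': "C *v x' + D *v u' \<in> Y" "(A *v x' + B *v u', v') \<in> ?G"
      "norm (u' - \<mu> 0) \<le> L1 * d" unfolding d_def S_def by auto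
    define y' where "y' = A *v x' + B *v u'"
    from L(2)[OF y u'(2)] obtain \<mu>1 where \<mu>1: "ocp_feasible A B C D Y T n y' v' \<mu>1"
      "\<forall>i<n. norm (\<mu>1 i - \<mu> (Suc i)) \<le> L * norm ((y', v') - (y, v))"
      "\<forall>i\<le>n. norm (pred_state A B y' \<mu>1 i - pred_state A B y (\<lambda>j. \<mu> (Suc j)) i)
          \<le> L * norm ((y', v') - (y, v))"
      unfolding y'_def by blast
    have "norm (y' - y) \<le> a * norm (x' - x) + b * norm (u' - \<mu> 0)"
    proof -
      have "y' - y = A *v (x' - x) + B *v (u' - \<mu> 0)"
        by (simp add: y_def y'_def matrix_vector_mult_diff_distrib)
      also have "norm \<dots> \<le> a * norm (x' - x) + b * norm (u' - \<mu> 0)"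
        unfolding a_def b_def by (intro norm_triangle_mono onorm) auto
      finally show ?thesis .
    qed
    also have "\<dots> \<le> a * d + b * (L1 * d)" using ab dx u'(3) by (intro add_mono mult_left_mono)
    finally have "norm (y' - y) \<le> (a + b * L1) * d" by (simp add: algebra_simps)
    then have "norm ((y', v') - (y, v)) \<le> (a + b * L1 + 1) * d"
      using norm_Pair_le[of "y' - y" "v' - v"] dv by (simp add: algebra_simps)
    then have "L * norm ((y', v') - (y, v)) \<le> L * (a + b * L1 + 1) * d"
      unfolding mult.assoc by (rule mult_left_mono[OF _ L(1)])
    also have "\<dots> \<le> L2 * d" using L2(3) d0 by (rule mult_right_mono)
    finally have y'y: "L * norm ((y', v') - (y, v)) \<le> L2 * d" .
    define \<mu>' where "\<mu>' = case_nat u' \<mu>1"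
    have "ocp_feasible A B C D Y T (Suc n) x' v' \<mu>'"
      using u' \<mu>1(1) by (simp add: ocp_feasible_Suc \<mu>'_def y'_def)
    moreover have "norm (\<mu>' i - \<mu> i) \<le> L2 * d" if "i < Suc n" for i
    proof (cases i)
      case 0
      then show ?thesis using u'(3) mult_right_mono[OF L2(2) d0] by (simp add: \<mu>'_def)
    next
      case (Suc j)
      then show ?thesis using \<mu>1(2) that y'y order_trans by (auto simp: \<mu>'_def)
    qed
    moreover have "norm (pred_state A B x' \<mu>' i - pred_state A B x \<mu> i) \<le> L2 * d" if "i \<le> Suc n" for i
    proof (cases i)
      case 0
      then show ?thesis using dx mult_right_mono[OF L2(1) d0] by simp
    next
      case (Suc j)
      then have "norm (pred_state A B y' \<mu>1 j - pred_state A B y (\<lambda>j. \<mu> (Suc j)) j) \<le> L2 * d"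
        using \<mu>1(3) that y'y order_trans by auto
      then show ?thesis
        unfolding Suc pred_state_Suc_shift by (simp add: \<mu>'_def y_def y'_def)
    qed
    ultimately show ?thesis unfolding d_def by blast
  qed
  moreover have "L2 \<ge> 0" using L2(1) by simp
  ultimately show ?case by blast
qed

section \<open>The optimal value of the control problem\<close>

lemmas continuous_on_matrix_vector_mult [continuous_intros] =
  bounded_linear.continuous_on[OF matrix_vector_mul_bounded_linear]

lemma continuous_on_wnorm [continuous_intros]:
  assumes "continuous_on S f"
  shows "continuous_on S (\<lambda>x. wnorm M (f x))"
  unfolding wnorm_def
  by (intro continuous_intros assms)

lemma ocp_data_cong:
  assumes "\<And>i. i < n \<Longrightarrow> \<mu> i = \<mu>' i"
  shows "ocp_feasible A B C D Y T n x v \<mu> \<longleftrightarrow> ocp_feasible A B C D Y T n x v \<mu>'"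
    and "ocp_cost A B Gx Gu P Q R n x v \<mu> = ocp_cost A B Gx Gu P Q R n x v \<mu>'"
proof -
  have "pred_state A B x \<mu> i = pred_state A B x \<mu>' i" if "i \<le> n" for i
    using that assms by (intro pred_state_cong) auto
  then show "ocp_feasible A B C D Y T n x v \<mu> \<longleftrightarrow> ocp_feasible A B C D Y T n x v \<mu>'"
    and "ocp_cost A B Gx Gu P Q R n x v \<mu> = ocp_cost A B Gx Gu P Q R n x v \<mu>'"
    using assms by (simp_all add: ocp_feasible_def ocp_cost_def)
qed

lemma ocp_cost_nonneg:
  "0 \<le> ocp_cost A B Gx Gu P Q R n x v \<mu>"
  unfolding ocp_cost_def by (intro add_nonneg_nonneg sum_nonneg) auto

lemma ocp_cost_Suc:
  "ocp_cost A B Gx Gu P Q R (Suc n) x v \<mu> =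
     (wnorm Q (x - Gx *v v))\<^sup>2 + (wnorm R (\<mu> 0 - Gu *v v))\<^sup>2 +
     ocp_cost A B Gx Gu P Q R n (A *v x + B *v \<mu> 0) v (\<lambda>j. \<mu> (Suc j))"
  unfolding ocp_cost_def sum.lessThan_Suc_shift
  by (simp add: pred_state_Suc_shift del: pred_state.simps(2))

lemma ocp_cost_snoc:
  "ocp_cost A B Gx Gu P Q R (Suc n) x v \<mu> =
     ocp_cost A B Gx Gu P Q R n x v \<mu>
     - (wnorm P (pred_state A B x \<mu> n - Gx *v v))\<^sup>2
     + (wnorm Q (pred_state A B x \<mu> n - Gx *v v))\<^sup>2 + (wnorm R (\<mu> n - Gu *v v))\<^sup>2
     + (wnorm P (A *v pred_state A B x \<mu> n + B *v \<mu> n - Gx *v v))\<^sup>2"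
  unfolding ocp_cost_def by simp

lemma ocp_feasible_snoc:
  "ocp_feasible A B C D Y T (Suc n) x v \<mu> \<longleftrightarrow>
     (\<forall>i<n. C *v pred_state A B x \<mu> i + D *v \<mu> i \<in> Y) \<and>
     C *v pred_state A B x \<mu> n + D *v \<mu> n \<in> Y \<and>
     (A *v pred_state A B x \<mu> n + B *v \<mu> n, v) \<in> T"
  unfolding ocp_feasible_def by (auto simp: less_Suc_eq)

text \<open>The cost is the squared Euclidean norm of the vector of its weighted deviations, so Minkowski's
  inequality applies to its square root. The squared cost itself would only be locally Lipschitz.\<close>

lemma sqrt_ocp_cost_lipschitz:
  fixes A :: "real^'nx^'nx" and B :: "real^'nu^'nx" and Gx :: "real^'nv^'nx" and Gu :: "real^'nv^'nu"
  assumes P: "sym_psd P" and Q: "sym_psd Q" and R: "sym_psd R"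
  shows "\<exists>c\<ge>0. \<forall>x v \<mu> x' v' \<mu>' d.
    (\<forall>i<n. norm (\<mu>' i - \<mu> i) \<le> d) \<and>
    (\<forall>i\<le>n. norm (pred_state A B x' \<mu>' i - pred_state A B x \<mu> i) \<le> d) \<and> norm (v' - v) \<le> d \<longrightarrow>
    sqrt (ocp_cost A B Gx Gu P Q R n x' v' \<mu>') \<le> sqrt (ocp_cost A B Gx Gu P Q R n x v \<mu>) + c * d"
proof -
  obtain cP cQ cR where c: "cP \<ge> 0" "cQ \<ge> 0" "cR \<ge> 0" "\<And>x. wnorm P x \<le> cP * norm x"
    "\<And>x. wnorm Q x \<le> cQ * norm x" "\<And>x. wnorm R x \<le> cR * norm x"
    using wnorm_le_norm[OF P] wnorm_le_norm[OF Q] wnorm_le_norm[OF R] by metis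
  define gx where "gx = onorm ((*v) Gx)"
  define gu where "gu = onorm ((*v) Gu)"
  have g: "gx \<ge> 0" "gu \<ge> 0" by (simp_all add: gx_def gu_def onorm_pos_le)
  define c0 where "c0 = (cP + cQ) * (1 + gx) + cR * (1 + gu)"
  define J where "J = {..<n} <+> {..n}"
  have fin: "finite J" by (simp add: J_def)
  define z where "z x v \<mu> = case_sum (\<lambda>i. wnorm R (\<mu> i - Gu *v v))
    (\<lambda>i. wnorm (if i < n then Q else P) (pred_state A B x \<mu> i - Gx *v v))" for x v \<mu>
  have cost: "sqrt (ocp_cost A B Gx Gu P Q R n x v \<mu>) = L2_set (z x v \<mu>) J" for x v \<mu>
    unfolding L2_set_def J_def ocp_cost_def z_def
    by (simp add: sum.Plus sum.distrib flip: lessThan_Suc_atMost)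
  have gen: "wnorm M (y' - G *v v') \<le> wnorm M (y - G *v v) + cM * (1 + gM) * d"
    if "sym_psd M" "cM \<ge> 0" "\<And>x. wnorm M x \<le> cM * norm x" "norm (y' - y) \<le> d" "norm (v' - v) \<le> d"
      "gM = onorm ((*v) G)"
    for M :: "real^'m^'m" and y y' G and v v' :: "real^'nv" and cM gM d
  proof -
    have "wnorm M (y' - G *v v') = wnorm M ((y - G *v v) + ((y' - y) - G *v (v' - v)))"
      by (simp add: matrix_vector_mult_diff_distrib algebra_simps)
    also have "\<dots> \<le> wnorm M (y - G *v v) + wnorm M ((y' - y) - G *v (v' - v))"
      by (rule wnorm_triangle[OF that(1)])
    also have "wnorm M ((y' - y) - G *v (v' - v)) \<le> cM * norm ((y' - y) - G *v (v' - v))"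
      by (rule that(3))
    also have "\<dots> \<le> cM * (d + gM * d)"
    proof (rule mult_left_mono[OF _ that(2)])
      have "norm (G *v (v' - v)) \<le> gM * norm (v' - v)" unfolding that(6) by (rule onorm) simp
      also have "\<dots> \<le> gM * d" using that(5) unfolding that(6)
        by (rule mult_left_mono) (simp add: onorm_pos_le)
      finally show "norm ((y' - y) - G *v (v' - v)) \<le> d + gM * d"
        using norm_triangle_ineq4[of "y' - y" "G *v (v' - v)"] that(4) by linarith
    qed
    finally show ?thesis by (simp add: algebra_simps)
  qed
  have "sqrt (ocp_cost A B Gx Gu P Q R n x' v' \<mu>')
      \<le> sqrt (ocp_cost A B Gx Gu P Q R n x v \<mu>) + (sqrt (card J) * c0) * d"
    if H: "\<forall>i<n. norm (\<mu>' i - \<mu> i) \<le> d"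
      "\<forall>i\<le>n. norm (pred_state A B x' \<mu>' i - pred_state A B x \<mu> i) \<le> d" "norm (v' - v) \<le> d"
    for x v \<mu> x' v' \<mu>' d
  proof -
    have d: "d \<ge> 0" using H(3) norm_ge_zero order_trans by blast
    have le: "cP * (1 + gx) * d \<le> c0 * d" "cQ * (1 + gx) * d \<le> c0 * d" "cR * (1 + gu) * d \<le> c0 * d"
      using c(1-3) g d by (auto intro!: mult_right_mono simp: c0_def algebra_simps)
    have pos: "0 \<le> z x' v' \<mu>' j" for j
      using P Q R by (auto simp: z_def split: sum.split)
    have comp: "z x' v' \<mu>' j \<le> z x v \<mu> j + c0 * d" if "j \<in> J" for j
    proof (cases j)
      case (Inl i)
      with that have i: "i < n" by (auto simp: J_def)
      show ?thesis
        using gen[OF R c(3,6) _ H(3) gu_def, of "\<mu>' i" "\<mu> i"] H(1) i le(3) by (auto simp: Inl z_def)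
    next
      case (Inr i)
      with that have i: "i \<le> n" by (auto simp: J_def)
      show ?thesis
        using gen[OF P c(1,4) _ H(3) gx_def, of "pred_state A B x' \<mu>' i" "pred_state A B x \<mu> i"]
          gen[OF Q c(2,5) _ H(3) gx_def, of "pred_state A B x' \<mu>' i" "pred_state A B x \<mu> i"]
          H(2) i le(1,2) by (auto simp: Inr z_def)
    qed
    have "L2_set (z x' v' \<mu>') J \<le> L2_set (\<lambda>j. z x v \<mu> j + c0 * d) J"
      by (rule L2_set_mono) (use comp pos in auto)
    also have "\<dots> \<le> L2_set (z x v \<mu>) J + L2_set (\<lambda>j. c0 * d) J" by (rule L2_set_triangle_ineq)
    also have "L2_set (\<lambda>j. c0 * d) J = sqrt (card J) * c0 * d"
      using c(1-3) g d by (simp add: L2_set_constant c0_def)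
    finally show ?thesis unfolding cost .
  qed
  moreover have "sqrt (card J) * c0 \<ge> 0" using c(1-3) g by (simp add: c0_def)
  ultimately show ?thesis by blast
qed

text \<open>Since \<open>R\<close> is definite, inputs of bounded cost are bounded. Setting the irrelevant inputs beyond the
  horizon to zero puts the competitors into a compact set of the product topology on sequences.\<close>

lemma ocp_minimizer_exists:
  fixes A :: "real^'nx^'nx" and B :: "real^'nu^'nx" and C :: "real^'nx^'ny" and D :: "real^'nu^'ny"
    and Gx :: "real^'nv^'nx" and Gu :: "real^'nv^'nu"
  assumes P: "sym_psd P" and Q: "sym_psd Q" and R: "sym_pd R" and Y: "closed Y" and T: "closed T"
    and mem: "(x, v) \<in> ocp_params A B C D Y T n"
  shows "\<exists>\<mu>. is_arg_min (ocp_cost A B Gx Gu P Q R n x v) (ocp_feasible A B C D Y T n x v) \<mu>"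
proof -
  let ?J = "ocp_cost A B Gx Gu P Q R n x v"
  let ?F = "ocp_feasible A B C D Y T n x v"
  obtain \<mu>0 where \<mu>0: "?F \<mu>0" using mem by (auto simp: ocp_params_def)
  obtain c where c: "c \<ge> 0" "\<And>w. norm w \<le> c * wnorm R w" using norm_le_wnorm[OF R] by metis
  note R' = sym_pd_imp_psd[OF R]
  define S where "S = {\<mu>. ?F \<mu>} \<inter> {\<mu>. ?J \<mu> \<le> ?J \<mu>0} \<inter> {\<mu>. \<forall>i\<ge>n. \<mu> i = 0}"
  define box where "box i = (if i < n then cball (Gu *v v) (c * sqrt (?J \<mu>0)) else {0})" for i
  have trunc: "\<exists>\<mu>'. ?F \<mu>' \<and> ?J \<mu>' = ?J \<mu> \<and> (\<forall>i\<ge>n. \<mu>' i = 0)" if "?F \<mu>" for \<mu>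
  proof -
    define \<mu>' where "\<mu>' i = (if i < n then \<mu> i else 0)" for i
    have "?F \<mu>' \<longleftrightarrow> ?F \<mu>" "?J \<mu>' = ?J \<mu>"
      by (rule ocp_data_cong; simp add: \<mu>'_def)+
    moreover have "\<forall>i\<ge>n. \<mu>' i = 0" by (simp add: \<mu>'_def)
    ultimately show ?thesis using that by blast
  qed
  have coord: "continuous_on UNIV (\<lambda>\<mu> :: nat \<Rightarrow> real^'nu. \<mu> i)" for i by simp
  have state: "continuous_on UNIV (\<lambda>\<mu>. pred_state A B x \<mu> i)" for i
    by (induction i) (auto intro!: continuous_intros coord)
  have cost: "continuous_on UNIV ?J"
    unfolding ocp_cost_def by (intro continuous_intros state coord)
  have out: "continuous_on UNIV (\<lambda>\<mu>. C *v pred_state A B x \<mu> i + D *v \<mu> i)" for i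
    by (intro continuous_intros state coord)
  have "closed {\<mu>. ?F \<mu>}"
    unfolding ocp_feasible_def
    by (intro closed_Collect_conj closed_Collect_all closed_Collect_imp open_Collect_const
        closed_vimage[OF Y out, unfolded vimage_def]
        closed_vimage[OF T continuous_on_Pair[OF state continuous_on_const], unfolded vimage_def])
  moreover have "closed {\<mu>. ?J \<mu> \<le> ?J \<mu>0}"
    by (intro closed_Collect_le cost continuous_on_const)
  moreover have "closed {\<mu> :: nat \<Rightarrow> real^'nu. \<forall>i\<ge>n. \<mu> i = 0}"
    by (intro closed_Collect_all closed_Collect_imp open_Collect_const closed_Collect_eq coord
        continuous_on_const)
  ultimately have "closed S" unfolding S_def by (intro closed_Int)
  moreover have "S \<subseteq> PiE UNIV box"
  proof
    fix \<mu> assume \<mu>: "\<mu> \<in> S"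
    have "\<mu> i \<in> box i" for i
    proof (cases "i < n")
      case True
      have "(wnorm R (\<mu> i - Gu *v v))\<^sup>2 \<le> (\<Sum>i<n. (wnorm Q (pred_state A B x \<mu> i - Gx *v v))\<^sup>2 + (wnorm R (\<mu> i - Gu *v v))\<^sup>2)"
        using member_le_sum[of i "{..<n}" "\<lambda>i. (wnorm Q (pred_state A B x \<mu> i - Gx *v v))\<^sup>2 + (wnorm R (\<mu> i - Gu *v v))\<^sup>2"]
          True by (smt (verit) finite_lessThan lessThan_iff zero_le_power2 add_nonneg_nonneg)
      also have "\<dots> \<le> ?J \<mu>" unfolding ocp_cost_def by simp
      also have "\<dots> \<le> ?J \<mu>0" using \<mu> by (simp add: S_def)
      finally have "wnorm R (\<mu> i - Gu *v v) \<le> sqrt (?J \<mu>0)" by (rule real_le_rsqrt)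
      then have "norm (\<mu> i - Gu *v v) \<le> c * sqrt (?J \<mu>0)"
        using c order_trans mult_left_mono by meson
      then show ?thesis using True by (simp add: box_def dist_norm norm_minus_commute)
    next
      case False
      then show ?thesis using \<mu> by (simp add: S_def box_def)
    qed
    then show "\<mu> \<in> PiE UNIV box" by auto
  qed
  moreover have "compact (PiE UNIV box)"
    using compactin_PiE[of "\<lambda>_. euclidean" UNIV box]
    by (auto simp: euclidean_product_topology box_def)
  ultimately have "compact S" by (metis compact_Int_closed inf.absorb_iff2)
  moreover have "S \<noteq> {}"
  proof -
    from trunc[OF \<mu>0] obtain \<mu>1 where "?F \<mu>1" "?J \<mu>1 = ?J \<mu>0" "\<forall>i\<ge>n. \<mu>1 i = 0" by blast
    then have "\<mu>1 \<in> S" by (simp add: S_def)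
    then show ?thesis by blast
  qed
  ultimately obtain \<mu>s where \<mu>s: "\<mu>s \<in> S" "\<And>\<mu>. \<mu> \<in> S \<Longrightarrow> ?J \<mu>s \<le> ?J \<mu>"
    using continuous_attains_inf[of S ?J] continuous_on_subset[OF cost] by blast
  have "?J \<mu>s \<le> ?J \<mu>" if F: "?F \<mu>" for \<mu>
  proof (cases "?J \<mu> \<le> ?J \<mu>0")
    case True
    from trunc[OF F] obtain \<mu>' where \<mu>': "?F \<mu>'" "?J \<mu>' = ?J \<mu>" "\<forall>i\<ge>n. \<mu>' i = 0" by blast
    then have "\<mu>' \<in> S" using True by (simp add: S_def)
    then show ?thesis using \<mu>s(2) \<mu>'(2) by metis
  next
    case False
    then show ?thesis using \<mu>s(1) by (simp add: S_def)
  qed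
  then show ?thesis using \<mu>s(1) by (auto simp: is_arg_min_linorder S_def)
qed

text \<open>The data of the optimal control problem. The kernel basis is represented by its consequence that
  \<open>G\<^sub>x v\<close> is a steady state under the input \<open>G\<^sub>u v\<close>.\<close>

locale mpc =
  fixes A :: "real^'nx^'nx" and B :: "real^'nu^'nx"
    and C :: "real^'nx^'ny" and D :: "real^'nu^'ny"
    and Gx :: "real^'nv^'nx" and Gu :: "real^'nv^'nu"
    and P Q :: "real^'nx^'nx" and R :: "real^'nu^'nu" and K :: "real^'nx^'nu"
    and Y :: "(real^'ny) set" and T :: "((real^'nx) \<times> (real^'nv)) set" and N :: nat
  assumes equilibrium: "\<And>v. A *v (Gx *v v) + B *v (Gu *v v) = Gx *v v"
    and horizon: "1 \<le> N"
    and Y: "polyhedron Y"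
    and Q: "sym_psd Q" and obs: "observable A Q" and R: "sym_pd R" and P: "sym_psd P"
    and T: "polyhedron T"
    and terminal_decrease: "\<And>x v. (x, v) \<in> T \<Longrightarrow>
          (wnorm P ((A - B ** K) *v (x - Gx *v v)))\<^sup>2 - (wnorm P (x - Gx *v v))\<^sup>2
            \<le> - (wnorm (Q + transpose K ** R ** K) (x - Gx *v v))\<^sup>2"
    and terminal_invariant: "\<And>x v. (x, v) \<in> T \<Longrightarrow>
          (A *v x + B *v terminal_law Gx Gu K x v, v) \<in> T"
    and terminal_constraint: "\<And>x v. (x, v) \<in> T \<Longrightarrow>
          C *v x + D *v terminal_law Gx Gu K x v \<in> Y"
begin

abbreviation "feasible \<equiv> ocp_feasible A B C D Y T N"
abbreviation "cost \<equiv> ocp_cost A B Gx Gu P Q R N"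
abbreviation "params \<equiv> ocp_params A B C D Y T N"

definition optimal_input :: "real^'nx \<Rightarrow> real^'nv \<Rightarrow> nat \<Rightarrow> real^'nu" where
  "optimal_input x v = arg_min (cost x v) (feasible x v)"

text \<open>The square root of the optimal value is used throughout because, unlike the value itself, it is
  globally Lipschitz.\<close>

definition root_value :: "real^'nx \<Rightarrow> real^'nv \<Rightarrow> real" where
  "root_value x v = sqrt (cost x v (optimal_input x v))"

definition closed_loop :: "real^'nx \<Rightarrow> real^'nv \<Rightarrow> real^'nx" where
  "closed_loop x v = A *v x + B *v optimal_input x v 0"

lemmas R_psd = sym_pd_imp_psd[OF R]

lemma optimal_input_is_arg_min:
  assumes "(x, v) \<in> params"
  shows "is_arg_min (cost x v) (feasible x v) (optimal_input x v)"
  unfolding optimal_input_def arg_min_def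
  by (rule someI_ex[OF ocp_minimizer_exists[OF P Q R _ _ assms]])
    (simp_all add: Y T polyhedron_imp_closed)

lemma optimal_input_feasible: "(x, v) \<in> params \<Longrightarrow> feasible x v (optimal_input x v)"
  using optimal_input_is_arg_min by (auto simp: is_arg_min_def)

lemma root_value_le: "feasible x v \<mu> \<Longrightarrow> root_value x v \<le> sqrt (cost x v \<mu>)"
  using optimal_input_is_arg_min[of x v]
  by (auto simp: root_value_def is_arg_min_linorder ocp_params_def)

lemma root_value_nonneg: "0 \<le> root_value x v"
  by (simp add: root_value_def ocp_cost_nonneg)

lemma root_value_sq: "(root_value x v)\<^sup>2 = cost x v (optimal_input x v)"
  by (simp add: root_value_def ocp_cost_nonneg)

text \<open>An optimal sequence for one parameter is moved to a feasible sequence for the other.\<close>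

proposition root_value_lipschitz:
  obtains c where "c \<ge> 0" "\<And>x v x' v'. (x, v) \<in> params \<Longrightarrow> (x', v') \<in> params \<Longrightarrow>
      root_value x' v' \<le> root_value x v + c * norm ((x', v') - (x, v))"
proof -
  obtain L where L: "L \<ge> 0" "\<And>x v \<mu> x' v'. feasible x v \<mu> \<Longrightarrow> (x', v') \<in> params \<Longrightarrow>
      \<exists>\<mu>'. feasible x' v' \<mu>' \<and> (\<forall>i<N. norm (\<mu>' i - \<mu> i) \<le> L * norm ((x', v') - (x, v))) \<and>
       (\<forall>i\<le>N. norm (pred_state A B x' \<mu>' i - pred_state A B x \<mu> i) \<le> L * norm ((x', v') - (x, v)))"
    using ocp_feasible_lipschitz[OF Y T, of A B C D N] by blast
  obtain c where c: "c \<ge> 0" "\<And>x v \<mu> x' v' \<mu>' d.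
    \<forall>i<N. norm (\<mu>' i - \<mu> i) \<le> d \<Longrightarrow>
    \<forall>i\<le>N. norm (pred_state A B x' \<mu>' i - pred_state A B x \<mu> i) \<le> d \<Longrightarrow> norm (v' - v) \<le> d \<Longrightarrow>
    sqrt (cost x' v' \<mu>') \<le> sqrt (cost x v \<mu>) + c * d"
    using sqrt_ocp_cost_lipschitz[OF P Q R_psd, of N A B Gx Gu] by blast
  have "root_value x' v' \<le> root_value x v + (c * (L + 1)) * norm ((x', v') - (x, v))"
    if xv: "(x, v) \<in> params" and xv': "(x', v') \<in> params" for x v x' v'
  proof -
    let ?d = "norm ((x', v') - (x, v))" and ?\<mu> = "optimal_input x v"
    obtain \<mu>' where \<mu>': "feasible x' v' \<mu>'" "\<forall>i<N. norm (\<mu>' i - ?\<mu> i) \<le> L * ?d"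
      "\<forall>i\<le>N. norm (pred_state A B x' \<mu>' i - pred_state A B x ?\<mu> i) \<le> L * ?d"
      using L(2)[OF optimal_input_feasible[OF xv] xv'] by blast
    have "L * ?d \<le> (L + 1) * ?d" by (simp add: algebra_simps)
    moreover have "norm (v' - v) \<le> (L + 1) * ?d"
      using norm_snd_le[of "v' - v" "x' - x"] mult_nonneg_nonneg[OF L(1) norm_ge_zero[of "(x', v') - (x, v)"]]
      by (simp add: algebra_simps)
    ultimately have "sqrt (cost x' v' \<mu>') \<le> sqrt (cost x v ?\<mu>) + c * ((L + 1) * ?d)"
      using \<mu>'(2,3) order_trans by (intro c(2)) blast+
    then have "sqrt (cost x' v' \<mu>') \<le> root_value x v + c * (L + 1) * ?d"
      unfolding root_value_def mult.assoc .
    with root_value_le[OF \<mu>'(1)] show ?thesis by linarith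
  qed
  moreover have "c * (L + 1) \<ge> 0" using c(1) L(1) by simp
  ultimately show thesis using that by blast
qed

text \<open>The terminal inequality rewritten as a one-step decrease of the terminal cost by the stage cost, the
  form in which it cancels in cost differences.\<close>

lemma terminal_cost_decrease:
  assumes "(x, v) \<in> T"
  defines "u \<equiv> terminal_law Gx Gu K x v"
  shows "(wnorm P (A *v x + B *v u - Gx *v v))\<^sup>2 + (wnorm Q (x - Gx *v v))\<^sup>2
    + (wnorm R (u - Gu *v v))\<^sup>2 \<le> (wnorm P (x - Gx *v v))\<^sup>2"
proof -
  define \<delta> where "\<delta> = x - Gx *v v"
  have u: "u = Gu *v v - K *v \<delta>" by (simp add: u_def terminal_law_def \<delta>_def)
  have "A *v x + B *v u - Gx *v v = (A - B ** K) *v \<delta>"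
  proof -
    have "A *v x + B *v u - Gx *v v = (A *v x - A *v (Gx *v v)) - B *v (K *v \<delta>)"
      using equilibrium[of v] by (simp add: u matrix_vector_mult_diff_distrib algebra_simps)
    then show ?thesis
      by (simp add: \<delta>_def matrix_vector_mult_diff_rdistrib matrix_vector_mult_diff_distrib
          flip: matrix_vector_mul_assoc)
  qed
  moreover have "\<delta> \<bullet> ((Q + transpose K ** R ** K) *v \<delta>) =
      (wnorm Q \<delta>)\<^sup>2 + (wnorm R (u - Gu *v v))\<^sup>2"
  proof -
    have "\<delta> \<bullet> ((transpose K ** R ** K) *v \<delta>) = (K *v \<delta>) \<bullet> (R *v (K *v \<delta>))"
      by (metis dot_lmul_matrix matrix_vector_mul_assoc vector_transpose_matrix)
    moreover have "(wnorm R (u - Gu *v v))\<^sup>2 = (K *v \<delta>) \<bullet> (R *v (K *v \<delta>))"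
      using wnorm_scaleR[OF R_psd, of "-1" "K *v \<delta>"] by (simp add: u wnorm_sq[OF R_psd])
    ultimately show ?thesis
      by (simp add: matrix_vector_mult_add_rdistrib inner_add_right wnorm_sq[OF Q])
  qed
  then have "(wnorm (Q + transpose K ** R ** K) \<delta>)\<^sup>2 = (wnorm Q \<delta>)\<^sup>2 + (wnorm R (u - Gu *v v))\<^sup>2"
    unfolding wnorm_def[of "Q + transpose K ** R ** K"] by simp
  ultimately show ?thesis using terminal_decrease[OF assms(1)] by (simp add: \<delta>_def)
qed

text \<open>The shifted optimal sequence, completed by the terminal controller, is feasible for the successor
  state. Its cost is the old one minus the first stage, plus a last stage which the terminal cost pays
  for.\<close>

lemma closed_loop_descent:
  assumes "(x, v) \<in> params"
  shows "(closed_loop x v, v) \<in> params"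
    and "(root_value (closed_loop x v) v)\<^sup>2 + (wnorm Q (x - Gx *v v))\<^sup>2
      + (wnorm R (optimal_input x v 0 - Gu *v v))\<^sup>2 \<le> (root_value x v)\<^sup>2"
proof -
  define \<mu> where "\<mu> = optimal_input x v"
  obtain n where N: "N = Suc n" using horizon by (cases N) auto
  define y where "y = A *v x + B *v \<mu> 0"
  define \<xi> where "\<xi> = pred_state A B x \<mu> N"
  define \<mu>' where "\<mu>' i = (if i < n then \<mu> (Suc i) else terminal_law Gx Gu K \<xi> v)" for i
  have feas: "feasible x v \<mu>" using optimal_input_feasible[OF assms] by (simp add: \<mu>_def)
  then have \<xi>T: "(\<xi>, v) \<in> T" by (simp add: ocp_feasible_def \<xi>_def)
  have shift: "pred_state A B y \<mu>' i = pred_state A B y (\<lambda>j. \<mu> (Suc j)) i" if "i \<le> n" for i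
    using that by (intro pred_state_cong) (auto simp: \<mu>'_def)
  then have \<xi>: "pred_state A B y \<mu>' n = \<xi>" unfolding \<xi>_def N pred_state_Suc_shift by (simp add: y_def)
  have "ocp_feasible A B C D Y T n y v (\<lambda>j. \<mu> (Suc j))"
    using feas unfolding N by (simp add: ocp_feasible_Suc y_def)
  then have 1: "feasible y v \<mu>'"
    unfolding N ocp_feasible_snoc \<xi>
    using terminal_invariant[OF \<xi>T] terminal_constraint[OF \<xi>T] shift
    by (auto simp: ocp_feasible_def \<mu>'_def)
  then show "(closed_loop x v, v) \<in> params"
    by (auto simp: ocp_params_def closed_loop_def y_def \<mu>_def)
  have "cost y v \<mu>' \<le> ocp_cost A B Gx Gu P Q R n y v \<mu>'"
    using terminal_cost_decrease[OF \<xi>T] unfolding N ocp_cost_snoc \<xi> by (simp add: \<mu>'_def)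
  also have "\<dots> = ocp_cost A B Gx Gu P Q R n y v (\<lambda>j. \<mu> (Suc j))"
    by (rule ocp_data_cong) (simp add: \<mu>'_def)
  also have "\<dots> = cost x v \<mu> - (wnorm Q (x - Gx *v v))\<^sup>2 - (wnorm R (\<mu> 0 - Gu *v v))\<^sup>2"
    unfolding N ocp_cost_Suc by (simp add: y_def)
  moreover have "(root_value y v)\<^sup>2 \<le> cost y v \<mu>'"
    using power_mono[OF root_value_le[OF 1] root_value_nonneg, of 2] by (simp add: ocp_cost_nonneg)
  ultimately show "(root_value (closed_loop x v) v)\<^sup>2 + (wnorm Q (x - Gx *v v))\<^sup>2
      + (wnorm R (optimal_input x v 0 - Gu *v v))\<^sup>2 \<le> (root_value x v)\<^sup>2"
    by (simp add: root_value_sq[of x] closed_loop_def y_def \<mu>_def)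
qed

text \<open>The observability estimate in deviation coordinates, with the weighted seminorms of the stage cost.\<close>

lemma detectability:
  obtains n M where "M \<ge> 0"
    "\<And>x u v s. (\<And>k. k < n \<Longrightarrow> x (Suc k) = A *v x k + B *v u k) \<Longrightarrow>
        (\<And>k. k < n \<Longrightarrow> wnorm Q (x k - Gx *v v) \<le> s) \<Longrightarrow>
        (\<And>k. k < n \<Longrightarrow> wnorm R (u k - Gu *v v) \<le> s) \<Longrightarrow>
        norm (x 0 - Gx *v v) \<le> M * s"
proof -
  obtain n M where M: "M \<ge> 0" and est: "\<And>\<delta> w s. (\<And>k. k < n \<Longrightarrow> \<delta> (Suc k) = A *v \<delta> k + B *v w k) \<Longrightarrow>
        (\<And>k. k < n \<Longrightarrow> norm (Q *v \<delta> k) \<le> s) \<Longrightarrow> (\<And>k. k < n \<Longrightarrow> norm (w k) \<le> s) \<Longrightarrow>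
        norm (\<delta> 0) \<le> M * s"
    using observability_estimate[OF obs, of B] by metis
  obtain cQ where cQ: "cQ \<ge> 0" "\<And>x. norm (Q *v x) \<le> cQ * wnorm Q x"
    using norm_mult_le_wnorm[OF Q] by metis
  obtain cR where cR: "cR \<ge> 0" "\<And>x. norm x \<le> cR * wnorm R x"
    using norm_le_wnorm[OF R] by metis
  show thesis
  proof
    show "M * (cQ + cR) \<ge> 0" using M cQ(1) cR(1) by simp
    fix x u v s
    assume 1: "\<And>k. k < n \<Longrightarrow> x (Suc k) = A *v x k + B *v u k"
      and 2: "\<And>k. k < n \<Longrightarrow> wnorm Q (x k - Gx *v v) \<le> s"
      and 3: "\<And>k. k < n \<Longrightarrow> wnorm R (u k - Gu *v v) \<le> s"
    have s: "s \<ge> 0" if "k < n" for k using 2[OF that] wnorm_nonneg[OF Q] order_trans by blast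
    have "norm (x 0 - Gx *v v) \<le> M * ((cQ + cR) * s)"
    proof (rule est)
      fix k assume k: "k < n"
      show "x (Suc k) - Gx *v v = A *v (x k - Gx *v v) + B *v (u k - Gu *v v)"
        using equilibrium[of v] by (simp add: 1[OF k] matrix_vector_mult_diff_distrib algebra_simps)
      have "norm (Q *v (x k - Gx *v v)) \<le> cQ * s"
        using cQ mult_left_mono[OF 2[OF k]] order_trans by blast
      then show "norm (Q *v (x k - Gx *v v)) \<le> (cQ + cR) * s"
        using mult_nonneg_nonneg[OF cR(1) s[OF k]] by (simp add: distrib_right)
      have "norm (u k - Gu *v v) \<le> cR * s"
        using cR mult_left_mono[OF 3[OF k]] order_trans by blast
      then show "norm (u k - Gu *v v) \<le> (cQ + cR) * s"
        using mult_nonneg_nonneg[OF cQ(1) s[OF k]] by (simp add: distrib_right)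
    qed
    then show "norm (x 0 - Gx *v v) \<le> M * (cQ + cR) * s" by (simp add: mult.assoc)
  qed
qed

end

section \<open>Convergence under a slowly varying reference\<close>

text \<open>Each residue class modulo \<open>n\<close> contracts geometrically; \<open>b\<close> bounds all classes at the start.\<close>

lemma delayed_contraction_tendsto_zero:
  fixes a e :: "nat \<Rightarrow> real"
  assumes n: "n \<ge> 1" and l: "0 \<le> l" "l < 1" and a: "\<And>k. a k \<ge> 0"
    and step: "\<And>k. a (k + n) \<le> l * a k + e k" and e: "e \<longlonglongrightarrow> 0"
  shows "a \<longlonglongrightarrow> 0"
proof (rule LIMSEQ_I)
  fix \<epsilon> :: real assume \<epsilon>: "0 < \<epsilon>"
  (* A perturbation \<open>\<eta>\<close> keeps the level \<open>\<epsilon> / 2\<close> invariant. *)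
  define \<eta> where "\<eta> = \<epsilon> / 2 * (1 - l)"
  have "\<eta> > 0" using \<epsilon> l by (simp add: \<eta>_def)
  then have "\<forall>\<^sub>F k in sequentially. e k < \<eta>" using order_tendstoD(2)[OF e] by blast
  then obtain k0 where k0: "\<And>k. k \<ge> k0 \<Longrightarrow> e k < \<eta>" by (auto simp: eventually_sequentially)
  define b where "b = (\<Sum>i<n. a (k0 + i))"
  have geo: "a (k0 + j * n + i) \<le> l ^ j * b + \<epsilon> / 2" if i: "i < n" for i j
  proof (induction j)
    case 0
    have "a (k0 + i) \<le> b" unfolding b_def
      using member_le_sum[of i "{..<n}" "\<lambda>i. a (k0 + i)"] i a by simp
    then show ?case using \<epsilon> by simp
  next
    case (Suc j)
    have "a (k0 + Suc j * n + i) = a (k0 + j * n + i + n)" by (simp add: algebra_simps)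
    also have "\<dots> \<le> l * a (k0 + j * n + i) + e (k0 + j * n + i)" by (rule step)
    also have "\<dots> \<le> l * (l ^ j * b + \<epsilon> / 2) + \<eta>"
      using Suc l k0[of "k0 + j * n + i"] by (intro add_mono mult_left_mono) auto
    also have "\<dots> = l ^ Suc j * b + \<epsilon> / 2" by (simp add: \<eta>_def field_simps)
    finally show ?case .
  qed
  have "(\<lambda>j. l ^ j * b) \<longlonglongrightarrow> 0"
    using tendsto_mult_right_zero[OF LIMSEQ_realpow_zero[OF l], of b] by (simp add: mult.commute)
  then have "\<forall>\<^sub>F j in sequentially. l ^ j * b < \<epsilon> / 2"
    by (rule order_tendstoD(2)) (use \<epsilon> in simp)
  then obtain j0 where j0: "\<And>j. j \<ge> j0 \<Longrightarrow> l ^ j * b < \<epsilon> / 2" by (auto simp: eventually_sequentially)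
  have "norm (a k - 0) < \<epsilon>" if k: "k \<ge> k0 + j0 * n" for k
  proof -
    define j where "j = (k - k0) div n"
    have "k = k0 + j * n + (k - k0) mod n" using k by (simp add: j_def)
    moreover have "(k - k0) mod n < n" using n by simp
    ultimately have "a k \<le> l ^ j * b + \<epsilon> / 2" using geo by metis
    moreover have "j \<ge> j0" using k n by (simp add: j_def less_eq_div_iff_mult_less_eq)
    ultimately show ?thesis using j0[of j] a[of k] by simp
  qed
  then show "\<exists>no. \<forall>k\<ge>no. norm (a k - 0) < \<epsilon>" by blast
qed

context mpc
begin

text \<open>Along the terminal controller the terminal cost decreases, so the stage costs tend to zero, and by
  observability the orbit converges to its equilibrium; the terminal set is closed.\<close>

lemma equilibrium_terminal:
  assumes "(x, v) \<in> T"
  shows "(Gx *v v, v) \<in> T"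
proof -
  obtain n M where M: "M \<ge> 0" and est: "\<And>x u v s. (\<And>k. k < n \<Longrightarrow> x (Suc k) = A *v x k + B *v u k) \<Longrightarrow>
        (\<And>k. k < n \<Longrightarrow> wnorm Q (x k - Gx *v v) \<le> s) \<Longrightarrow>
        (\<And>k. k < n \<Longrightarrow> wnorm R (u k - Gu *v v) \<le> s) \<Longrightarrow> norm (x 0 - Gx *v v) \<le> M * s"
    using detectability by metis
  define X where "X = rec_nat x (\<lambda>_ y. A *v y + B *v terminal_law Gx Gu K y v)"
  define u where "u k = terminal_law Gx Gu K (X k) v" for k
  have X: "X 0 = x" "\<And>k. X (Suc k) = A *v X k + B *v u k" by (simp_all add: X_def u_def)
  have XT: "(X k, v) \<in> T" for k
    by (induction k) (simp_all add: X assms u_def terminal_invariant)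
  define p where "p k = (wnorm P (X k - Gx *v v))\<^sup>2" for k
  have dec: "p (Suc k) + (wnorm Q (X k - Gx *v v))\<^sup>2 + (wnorm R (u k - Gu *v v))\<^sup>2 \<le> p k" for k
    using terminal_cost_decrease[OF XT[of k]] by (simp add: p_def X(2) u_def)
  have "decseq p"
    by (rule decseq_SucI) (use dec in \<open>smt (verit) zero_le_power2\<close>)
  then obtain p0 where p0: "p \<longlonglongrightarrow> p0"
    using decseq_convergent[of p 0] by (auto simp: p_def)
  have diff: "(\<lambda>k. p k - p (Suc k)) \<longlonglongrightarrow> 0"
    using tendsto_diff[OF p0 LIMSEQ_Suc[OF p0]] by simp
  have "X \<longlonglongrightarrow> Gx *v v"
  proof (rule LIMSEQ_I)
    fix \<epsilon> :: real assume \<epsilon>: "0 < \<epsilon>"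
    define s where "s = \<epsilon> / (M + 1)"
    have s: "s > 0" "M * s < \<epsilon>" using \<epsilon> M by (simp_all add: s_def field_simps)
    have "\<forall>\<^sub>F k in sequentially. p k - p (Suc k) < s\<^sup>2"
      using order_tendstoD(2)[OF diff] s(1) by simp
    then obtain k0 where k0: "\<And>k. k \<ge> k0 \<Longrightarrow> p k - p (Suc k) < s\<^sup>2"
      by (auto simp: eventually_sequentially)
    have small: "wnorm Q (X k - Gx *v v) \<le> s" "wnorm R (u k - Gu *v v) \<le> s" if "k \<ge> k0" for k
    proof -
      have "(wnorm Q (X k - Gx *v v))\<^sup>2 \<le> s\<^sup>2" "(wnorm R (u k - Gu *v v))\<^sup>2 \<le> s\<^sup>2"
        using dec[of k] k0[OF that] by (smt (verit) zero_le_power2)+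
      then show "wnorm Q (X k - Gx *v v) \<le> s" "wnorm R (u k - Gu *v v) \<le> s"
        using power2_le_imp_le s(1) by (meson less_imp_le)+
    qed
    have "norm (X k - Gx *v v) < \<epsilon>" if "k \<ge> k0" for k
    proof -
      have "norm (X (k + 0) - Gx *v v) \<le> M * s"
        by (rule est[of "\<lambda>i. X (k + i)" "\<lambda>i. u (k + i)"]) (use that in \<open>auto simp: X(2) intro!: small\<close>)
      then show ?thesis using s(2) by simp
    qed
    then show "\<exists>no. \<forall>k\<ge>no. norm (X k - Gx *v v) < \<epsilon>" by blast
  qed
  then have "(\<lambda>k. (X k, v)) \<longlonglongrightarrow> (Gx *v v, v)" by (intro tendsto_intros)
  then show ?thesis
    using closed_sequentially[OF polyhedron_imp_closed[OF T], of "\<lambda>k. (X k, v)"] XT by simp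
qed

text \<open>References whose equilibrium is feasible as a resting state: feasibility of the parameter supplies a
  point of the terminal set, and hence the terminal constraint at the equilibrium.\<close>

definition admissible :: "(real^'nv) set" where
  "admissible = {v. (Gx *v v, v) \<in> params \<and> C *v (Gx *v v) + D *v (Gu *v v) \<in> Y}"

lemma root_value_equilibrium:
  assumes "v \<in> admissible"
  shows "root_value (Gx *v v) v = 0"
proof -
  define \<mu> where "\<mu> i = Gu *v v" for i :: nat
  have state: "pred_state A B (Gx *v v) \<mu> i = Gx *v v" for i
    by (induction i) (simp_all add: \<mu>_def equilibrium)
  have "(Gx *v v, v) \<in> T"
    using assms equilibrium_terminal by (auto simp: admissible_def ocp_params_def ocp_feasible_def)
  then have "feasible (Gx *v v) v \<mu>"
    using assms by (simp add: ocp_feasible_def state admissible_def) (simp add: \<mu>_def)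
  from root_value_le[OF this] show ?thesis
    using root_value_nonneg[of "Gx *v v" v] by (simp add: ocp_cost_def state) (simp add: \<mu>_def)
qed

lemma root_value_le_norm:
  obtains c where "c \<ge> 0"
    "\<And>x v. (x, v) \<in> params \<Longrightarrow> v \<in> admissible \<Longrightarrow> root_value x v \<le> c * norm (x - Gx *v v)"
proof -
  obtain c where c: "c \<ge> 0" "\<And>x v x' v'. (x, v) \<in> params \<Longrightarrow> (x', v') \<in> params \<Longrightarrow>
      root_value x' v' \<le> root_value x v + c * norm ((x', v') - (x, v))"
    using root_value_lipschitz by metis
  have "root_value x v \<le> c * norm (x - Gx *v v)" if "(x, v) \<in> params" "v \<in> admissible" for x v
    using c(2)[of "Gx *v v" v x v] that root_value_equilibrium[OF that(2)]
    by (simp add: admissible_def norm_Pair)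
  with c(1) show thesis using that by blast
qed

lemma root_value_step:
  assumes "(x, v) \<in> params"
  shows root_value_closed_loop_le: "root_value (closed_loop x v) v \<le> root_value x v"
    and stage_le_root_value: "wnorm Q (x - Gx *v v) \<le> root_value x v"
      "wnorm R (optimal_input x v 0 - Gu *v v) \<le> root_value x v"
proof -
  have le: "y \<le> root_value x v" if "y\<^sup>2 \<le> (root_value x v)\<^sup>2" for y
    using that root_value_nonneg by (rule power2_le_imp_le)
  note closed_loop_descent(2)[OF assms] zero_le_power2[of "root_value (closed_loop x v) v"]
    zero_le_power2[of "wnorm Q (x - Gx *v v)"] zero_le_power2[of "wnorm R (optimal_input x v 0 - Gu *v v)"]
  then show "root_value (closed_loop x v) v \<le> root_value x v"
    "wnorm Q (x - Gx *v v) \<le> root_value x v"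
    "wnorm R (optimal_input x v 0 - Gu *v v) \<le> root_value x v"
    by - (rule le; linarith)+
qed

text \<open>The closed-loop orbit with frozen reference has stage costs bounded by the initial value, since the
  value does not increase along it. Following the orbit rather than the optimal prediction avoids
  comparing the horizon with the observability window.\<close>

lemma norm_le_root_value:
  obtains M where "M \<ge> 0" "\<And>x v. (x, v) \<in> params \<Longrightarrow> norm (x - Gx *v v) \<le> M * root_value x v"
proof -
  obtain n M where M: "M \<ge> 0" and est: "\<And>x u v s. (\<And>k. k < n \<Longrightarrow> x (Suc k) = A *v x k + B *v u k) \<Longrightarrow>
        (\<And>k. k < n \<Longrightarrow> wnorm Q (x k - Gx *v v) \<le> s) \<Longrightarrow>
        (\<And>k. k < n \<Longrightarrow> wnorm R (u k - Gu *v v) \<le> s) \<Longrightarrow> norm (x 0 - Gx *v v) \<le> M * s"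
    using detectability by metis
  have "norm (x - Gx *v v) \<le> M * root_value x v" if xv: "(x, v) \<in> params" for x v
  proof -
    define X where "X k = ((\<lambda>y. closed_loop y v) ^^ k) x" for k
    have X: "(X k, v) \<in> params" "root_value (X k) v \<le> root_value x v" for k
      by (induction k)
        (auto simp: X_def xv closed_loop_descent(1) intro: order_trans[OF root_value_closed_loop_le])
    have "norm (X 0 - Gx *v v) \<le> M * root_value x v"
    proof (rule est)
      show "X (Suc k) = A *v X k + B *v optimal_input (X k) v 0" for k
        by (simp add: X_def closed_loop_def)
      show "wnorm Q (X k - Gx *v v) \<le> root_value x v"
        "wnorm R (optimal_input (X k) v 0 - Gu *v v) \<le> root_value x v" for k
        using stage_le_root_value[OF X(1)[of k]] X(2)[of k] by linarith+
    qed
    then show ?thesis by (simp add: X_def)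
  qed
  with M show thesis using that by blast
qed

text \<open>Either some stage cost in the window is at least a fixed fraction of the value, and then the value
  drops by a fixed factor at that step; or all are small, and then observability, applied with the
  reference frozen at its initial value, bounds the initial value by the drift alone. Freezing the
  reference and changing it in the value function both cost a multiple of the drift.\<close>

proposition root_value_window_contraction:
  obtains n l c where "n \<ge> 1" "0 \<le> l" "l < 1"
    "\<And>x v. (\<And>k. k < n \<Longrightarrow> x (Suc k) = closed_loop (x k) (v k)) \<Longrightarrow>
        (\<And>k. k \<le> n \<Longrightarrow> (x k, v k) \<in> params) \<Longrightarrow> v 0 \<in> admissible \<Longrightarrow>
        root_value (x n) (v n) \<le> l * root_value (x 0) (v 0) + c * (\<Sum>k<n. norm (v (Suc k) - v k))"
proof -
  obtain n0 M where M: "M \<ge> 0" and est: "\<And>x u v s. (\<And>k. k < n0 \<Longrightarrow> x (Suc k) = A *v x k + B *v u k) \<Longrightarrow>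
        (\<And>k. k < n0 \<Longrightarrow> wnorm Q (x k - Gx *v v) \<le> s) \<Longrightarrow>
        (\<And>k. k < n0 \<Longrightarrow> wnorm R (u k - Gu *v v) \<le> s) \<Longrightarrow> norm (x 0 - Gx *v v) \<le> M * s"
    using detectability by metis
  (* A nonempty window, so that the contraction can be iterated. *)
  define n where "n = Suc n0"
  obtain c1 where c1: "c1 \<ge> 0" "\<And>x v x' v'. (x, v) \<in> params \<Longrightarrow> (x', v') \<in> params \<Longrightarrow>
      root_value x' v' \<le> root_value x v + c1 * norm ((x', v') - (x, v))"
    using root_value_lipschitz by metis
  obtain c2 where c2: "c2 \<ge> 0"
    "\<And>x v. (x, v) \<in> params \<Longrightarrow> v \<in> admissible \<Longrightarrow> root_value x v \<le> c2 * norm (x - Gx *v v)"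
    using root_value_le_norm by metis
  obtain cQ where cQ: "cQ \<ge> 0" "\<And>x. wnorm Q x \<le> cQ * norm x" using wnorm_le_norm[OF Q] by metis
  obtain cR where cR: "cR \<ge> 0" "\<And>x. wnorm R x \<le> cR * norm x" using wnorm_le_norm[OF R_psd] by metis
  define gx where "gx = onorm ((*v) Gx)"
  define gu where "gu = onorm ((*v) Gu)"
  have g: "gx \<ge> 0" "gu \<ge> 0" by (simp_all add: gx_def gu_def onorm_pos_le)
  define h where "h = cQ * gx + cR * gu"
  have h: "h \<ge> 0" "cQ * gx \<le> h" "cR * gu \<le> h" using cQ(1) cR(1) g by (simp_all add: h_def)
  (* Small enough that stage costs below \<open>a \<omega>\<close> give \<open>w 0 \<le> \<omega> / 2\<close> up to the drift. *)
  define a where "a = 1 / (2 * (1 + c2 * M))"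
  have a: "0 < a" "a \<le> 1 / 2" "c2 * M * a \<le> 1 / 2"
    using c2(1) M by (simp_all add: a_def field_simps add_pos_nonneg)
  define l where "l = sqrt (1 - a\<^sup>2)"
  have a2: "0 < a\<^sup>2" "a\<^sup>2 \<le> 1" using a by (simp_all add: power_le_one)
  have l: "0 \<le> l" "l < 1" using a2 by (simp_all add: l_def)
  define c where "c = 2 * c1 + 2 * (c2 * M * h)"
  have c2Mh: "c2 * M * h \<ge> 0" using c2(1) M h(1) by simp
  have "root_value (x n) (v n) \<le> l * root_value (x 0) (v 0) + c * (\<Sum>k<n. norm (v (Suc k) - v k))"
    if x: "\<And>k. k < n \<Longrightarrow> x (Suc k) = closed_loop (x k) (v k)"
      and mem: "\<And>k. k \<le> n \<Longrightarrow> (x k, v k) \<in> params" and v0: "v 0 \<in> admissible" for x v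
  proof -
    define S where "S k = (\<Sum>j<k. norm (v (Suc j) - v j))" for k
    define w where "w k = root_value (x k) (v k)" for k
    define W where "W k = root_value (x (Suc k)) (v k)" for k
    (* A bound for the value on the whole window. *)
    define \<omega> where "\<omega> = w 0 + c1 * S n"
    have S_mono: "S j \<le> S k" if "j \<le> k" for j k
      unfolding S_def using that by (intro sum_mono2) auto
    have S0: "0 \<le> S k" for k by (simp add: S_def sum_nonneg)
    have w0: "0 \<le> w k" for k by (simp add: w_def root_value_nonneg)
    have \<omega>0: "\<omega> \<ge> 0" using w0 c1(1) S0 by (simp add: \<omega>_def)
    have jump: "w (Suc k) \<le> W k + c1 * norm (v (Suc k) - v k)" if "k < n" for k
    proof -
      have "(x (Suc k), v k) \<in> params" using closed_loop_descent(1) mem[of k] x[OF that] that by simp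
      then show ?thesis using c1(2)[of "x (Suc k)" "v k" "x (Suc k)" "v (Suc k)"] mem[of "Suc k"] that
        by (simp add: w_def W_def norm_Pair)
    qed
    have desc: "(W k)\<^sup>2 + (wnorm Q (x k - Gx *v v k))\<^sup>2
        + (wnorm R (optimal_input (x k) (v k) 0 - Gu *v v k))\<^sup>2 \<le> (w k)\<^sup>2" if "k < n" for k
      using closed_loop_descent(2)[OF mem[of k]] x[OF that] that by (simp add: w_def W_def)
    have Ww: "W k \<le> w k" if "k < n" for k
      using root_value_closed_loop_le[OF mem[of k]] x[OF that] that by (simp add: w_def W_def)
    (* Compensated for the drift of the reference, the value decreases. *)
    have mono: "w m - c1 * S m \<le> w k - c1 * S k" if "k \<le> m" "m \<le> n" for k m
      using that
    proof (induction m rule: dec_induct)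
      case (step m)
      then show ?case using jump[of m] Ww[of m] by (simp add: S_def algebra_simps)
    qed simp
    have drift: "norm (v k - v 0) \<le> S k" for k
    proof (induction k)
      case (Suc k)
      then show ?case using norm_triangle_ineq[of "v (Suc k) - v k" "v k - v 0"] by (simp add: S_def)
    qed (simp add: S_def)
    have w\<omega>: "w k \<le> \<omega>" if "k \<le> n" for k
      using mono[of 0 k] that mult_left_mono[OF S_mono[OF that] c1(1)] by (simp add: \<omega>_def S_def)
    show ?thesis
    proof (cases "\<exists>k<n. wnorm Q (x k - Gx *v v k) > a * \<omega> \<or>
        wnorm R (optimal_input (x k) (v k) 0 - Gu *v v k) > a * \<omega>")
      case True
      then obtain k where k: "k < n" and big: "wnorm Q (x k - Gx *v v k) > a * \<omega> \<or>
        wnorm R (optimal_input (x k) (v k) 0 - Gu *v v k) > a * \<omega>" by blast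
      have a\<omega>: "0 \<le> a * \<omega>" using a(1) \<omega>0 by simp
      have "(a * \<omega>)\<^sup>2 \<le> (wnorm Q (x k - Gx *v v k))\<^sup>2 + (wnorm R (optimal_input (x k) (v k) 0 - Gu *v v k))\<^sup>2"
        using big
      proof
        assume "wnorm Q (x k - Gx *v v k) > a * \<omega>"
        then show ?thesis using power_mono[OF less_imp_le a\<omega>, of _ 2] by (simp add: add_increasing2)
      next
        assume "wnorm R (optimal_input (x k) (v k) 0 - Gu *v v k) > a * \<omega>"
        then show ?thesis using power_mono[OF less_imp_le a\<omega>, of _ 2] by (simp add: add_increasing)
      qed
      moreover have "(w k)\<^sup>2 \<le> \<omega>\<^sup>2" using w\<omega>[of k] w0 k by (intro power_mono) auto
      ultimately have "(W k)\<^sup>2 \<le> \<omega>\<^sup>2 - (a * \<omega>)\<^sup>2" using desc[OF k] by linarith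
      also have "\<dots> = (l * \<omega>)\<^sup>2" using a2 by (simp add: l_def power_mult_distrib algebra_simps)
      finally have "W k \<le> l * \<omega>" using l(1) \<omega>0 by (meson mult_nonneg_nonneg power2_le_imp_le)
      then have "w (Suc k) - c1 * S (Suc k) \<le> l * \<omega>"
        using jump[OF k] mult_nonneg_nonneg[OF c1(1) S0[of k]] by (simp add: S_def algebra_simps)
      then have "w n \<le> l * \<omega> + c1 * S n" using mono[of "Suc k" n] k by simp
      also have "l * \<omega> \<le> l * w 0 + c1 * S n"
        using mult_right_mono[OF less_imp_le[OF l(2)] mult_nonneg_nonneg[OF c1(1) S0[of n]]]
        by (simp add: \<omega>_def algebra_simps)
      finally have "w n \<le> l * w 0 + 2 * c1 * S n" by simp
      also have "\<dots> \<le> l * w 0 + c * S n"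
        using mult_right_mono[of "2 * c1" c "S n"] c2Mh S0[of n] by (simp add: c_def)
      finally show ?thesis by (simp add: w_def S_def)
    next
      case False
      then have small: "wnorm Q (x k - Gx *v v k) \<le> a * \<omega>"
        "wnorm R (optimal_input (x k) (v k) 0 - Gu *v v k) \<le> a * \<omega>" if "k < n" for k
        using that by (meson not_less)+
      have "norm (x 0 - Gx *v v 0) \<le> M * (a * \<omega> + h * S n)"
      proof (rule est)
        fix k assume "k < n0"
        then have k: "k < n" by (simp add: n_def)
        show "x (Suc k) = A *v x k + B *v optimal_input (x k) (v k) 0"
          using x[OF k] by (simp add: closed_loop_def)
        have dv: "norm (v k - v 0) \<le> S n" using drift[of k] S_mono[of k n] k by linarith
        have "wnorm Q (x k - Gx *v v 0) \<le> wnorm Q (x k - Gx *v v k) + wnorm Q (Gx *v (v k - v 0))"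
          using wnorm_triangle[OF Q, of "x k - Gx *v v k" "Gx *v (v k - v 0)"]
          by (simp add: matrix_vector_mult_diff_distrib)
        also have "wnorm Q (Gx *v (v k - v 0)) \<le> cQ * (gx * norm (v k - v 0))"
          unfolding gx_def using cQ onorm[of "(*v) Gx"] by (meson matrix_vector_mul_bounded_linear mult_left_mono order_trans)
        also have "\<dots> \<le> h * S n"
          using mult_mono[OF h(2) dv] h(1) by (simp add: mult.assoc)
        finally show "wnorm Q (x k - Gx *v v 0) \<le> a * \<omega> + h * S n" using small(1)[OF k] by linarith
        have "wnorm R (optimal_input (x k) (v k) 0 - Gu *v v 0)
            \<le> wnorm R (optimal_input (x k) (v k) 0 - Gu *v v k) + wnorm R (Gu *v (v k - v 0))"
          using wnorm_triangle[OF R_psd, of "optimal_input (x k) (v k) 0 - Gu *v v k" "Gu *v (v k - v 0)"]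
          by (simp add: matrix_vector_mult_diff_distrib)
        also have "wnorm R (Gu *v (v k - v 0)) \<le> cR * (gu * norm (v k - v 0))"
          unfolding gu_def using cR onorm[of "(*v) Gu"] by (meson matrix_vector_mul_bounded_linear mult_left_mono order_trans)
        also have "\<dots> \<le> h * S n"
          using mult_mono[OF h(3) dv] h(1) by (simp add: mult.assoc)
        finally show "wnorm R (optimal_input (x k) (v k) 0 - Gu *v v 0) \<le> a * \<omega> + h * S n"
          using small(2)[OF k] by linarith
      qed
      then have "c2 * norm (x 0 - Gx *v v 0) \<le> c2 * (M * (a * \<omega> + h * S n))"
        using c2(1) by (rule mult_left_mono)
      then have "w 0 \<le> c2 * (M * (a * \<omega> + h * S n))"
        using c2(2)[OF mem[of 0] v0] by (simp add: w_def)
      also have "\<dots> = (c2 * M * a) * \<omega> + c2 * M * h * S n" by (simp add: algebra_simps)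
      also have "\<dots> \<le> \<omega> / 2 + c2 * M * h * S n" using mult_right_mono[OF a(3) \<omega>0] by simp
      finally have "w 0 \<le> (c1 + 2 * (c2 * M * h)) * S n" by (simp add: \<omega>_def field_simps)
      then have "w n \<le> c * S n" using w\<omega>[of n] by (simp add: \<omega>_def c_def algebra_simps)
      also have "\<dots> \<le> l * w 0 + c * S n" using l(1) w0 by simp
      finally show ?thesis by (simp add: w_def S_def)
    qed
  qed
  then show thesis using that[of n l c] l by (simp add: n_def)
qed

theorem slow_reference_tracking:
  assumes x: "\<And>k. x (Suc k) = closed_loop (x k) (v k)"
    and mem: "\<And>k. (x k, v k) \<in> params" and adm: "\<And>k. v k \<in> admissible"
    and slow: "(\<lambda>k. v (Suc k) - v k) \<longlonglongrightarrow> 0"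
  shows "(\<lambda>k. x k - Gx *v v k) \<longlonglongrightarrow> 0"
proof -
  obtain n l c where n: "n \<ge> 1" and l: "0 \<le> l" "l < 1" and win:
    "\<And>x v. (\<And>k. k < n \<Longrightarrow> x (Suc k) = closed_loop (x k) (v k)) \<Longrightarrow>
        (\<And>k. k \<le> n \<Longrightarrow> (x k, v k) \<in> params) \<Longrightarrow> v 0 \<in> admissible \<Longrightarrow>
        root_value (x n) (v n) \<le> l * root_value (x 0) (v 0) + c * (\<Sum>k<n. norm (v (Suc k) - v k))"
    by (fact root_value_window_contraction)
  obtain M where M: "M \<ge> 0" "\<And>x v. (x, v) \<in> params \<Longrightarrow> norm (x - Gx *v v) \<le> M * root_value x v"
    using norm_le_root_value by metis
  have "(\<lambda>k. root_value (x k) (v k)) \<longlonglongrightarrow> 0"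
  proof (rule delayed_contraction_tendsto_zero[OF n l])
    show "root_value (x (k + n)) (v (k + n)) \<le> l * root_value (x k) (v k)
        + c * (\<Sum>j<n. norm (v (Suc (j + k)) - v (j + k)))" for k
      using win[of "\<lambda>j. x (j + k)" "\<lambda>j. v (j + k)"] x mem adm by (simp add: add.commute)
    have "(\<lambda>k. norm (v (Suc (j + k)) - v (j + k))) \<longlonglongrightarrow> 0" for j
      using LIMSEQ_ignore_initial_segment[OF tendsto_norm_zero[OF slow], of j] by (simp add: add.commute)
    then have "(\<lambda>k. \<Sum>j<n. norm (v (Suc (j + k)) - v (j + k))) \<longlonglongrightarrow> 0"
      by (rule tendsto_null_sum)
    then show "(\<lambda>k. c * (\<Sum>j<n. norm (v (Suc (j + k)) - v (j + k)))) \<longlonglongrightarrow> 0"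
      by (rule tendsto_mult_right_zero)
  qed (rule root_value_nonneg)
  then have "(\<lambda>k. M * root_value (x k) (v k)) \<longlonglongrightarrow> 0" by (rule tendsto_mult_right_zero)
  then show ?thesis by (rule Lim_null_comparison[rotated]) (simp add: M(2) mem)
qed

end

section \<open>The governor and the closed loop\<close>

text \<open>The constant \<open>c\<close> is half of the usual modulus of strong convexity.\<close>

definition strongly_convex :: "real \<Rightarrow> ('a::real_normed_vector \<Rightarrow> real) \<Rightarrow> bool" where
  "strongly_convex c \<psi> \<longleftrightarrow> (\<forall>u w. \<forall>t\<in>{0..1}.
     \<psi> ((1 - t) *\<^sub>R u + t *\<^sub>R w) \<le> (1 - t) * \<psi> u + t * \<psi> w - c * (t * (1 - t)) * (norm (u - w))\<^sup>2)"

text \<open>For squared norms the defect of convexity on a segment is exactly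
  \<open>t (1 - t) \<parallel>H u - H w\<parallel>\<^sup>2\<close>, and an injective linear map is bounded below.\<close>

lemma strongly_convex_sq_norm:
  fixes H :: "'a::euclidean_space \<Rightarrow> 'b::euclidean_space"
  assumes "linear H" "inj H"
  shows "\<exists>c>0. strongly_convex c (\<lambda>v. (norm (H v - h))\<^sup>2)"
proof -
  obtain b where b: "b > 0" "\<And>x. b * norm x \<le> norm (H x)"
    using linear_inj_bounded_below_pos[OF assms] by metis
  have "(norm (H ((1 - t) *\<^sub>R u + t *\<^sub>R w) - h))\<^sup>2 \<le> (1 - t) * (norm (H u - h))\<^sup>2 + t * (norm (H w - h))\<^sup>2
      - b\<^sup>2 * (t * (1 - t)) * (norm (u - w))\<^sup>2" if t: "t \<in> {0..1}" for u w t
  proof -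
    define p where "p = H u - h"
    define q where "q = H w - h"
    have "H ((1 - t) *\<^sub>R u + t *\<^sub>R w) = (1 - t) *\<^sub>R H u + t *\<^sub>R H w"
      by (simp add: linear_add[OF assms(1)] linear_scale[OF assms(1)])
    then have Hm: "H ((1 - t) *\<^sub>R u + t *\<^sub>R w) - h = (1 - t) *\<^sub>R p + t *\<^sub>R q"
      by (simp add: p_def q_def algebra_simps)
    have "(norm (H ((1 - t) *\<^sub>R u + t *\<^sub>R w) - h))\<^sup>2
        = (1 - t) * (norm p)\<^sup>2 + t * (norm q)\<^sup>2 - (t * (1 - t)) * (norm (p - q))\<^sup>2"
      unfolding Hm power2_norm_eq_inner
      by (simp add: inner_add_left inner_add_right inner_diff_left inner_diff_right
          inner_commute[of q p] algebra_simps)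
    moreover have "b\<^sup>2 * (norm (u - w))\<^sup>2 \<le> (norm (p - q))\<^sup>2"
      using power_mono[OF b(2)[of "u - w"], of 2] b(1)
      by (simp add: p_def q_def linear_diff[OF assms(1)] power_mult_distrib)
    then have "(t * (1 - t)) * (b\<^sup>2 * (norm (u - w))\<^sup>2) \<le> (t * (1 - t)) * (norm (p - q))\<^sup>2"
      using t by (intro mult_left_mono) auto
    ultimately show ?thesis by (simp add: p_def q_def algebra_simps)
  qed
  then have "strongly_convex (b\<^sup>2) (\<lambda>v. (norm (H v - h))\<^sup>2)" unfolding strongly_convex_def by blast
  with b(1) show ?thesis by (metis zero_less_power)
qed

text \<open>Compare the minimizer with the midpoint of the segment to \<open>v\<close>. The midpoint loses a factor two in the
  constant and needs no limit.\<close>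

lemma strongly_convex_minimizer_gap:
  assumes "strongly_convex c \<psi>" "convex S" "v0 \<in> S" "v \<in> S" "\<And>w. w \<in> S \<Longrightarrow> \<psi> v0 \<le> \<psi> w"
  shows "\<psi> v0 + c / 2 * (norm (v - v0))\<^sup>2 \<le> \<psi> v"
proof -
  let ?m = "(1 - 1 / 2) *\<^sub>R v + (1 / 2 :: real) *\<^sub>R v0"
  have "?m \<in> S" using convexD[OF assms(2) assms(4) assms(3), of "1 - 1 / 2" "1 / 2"] by simp
  then have "\<psi> v0 \<le> \<psi> ?m" by (rule assms(5))
  also have "\<dots> \<le> (1 - 1 / 2) * \<psi> v + 1 / 2 * \<psi> v0 - c * (1 / 2 * (1 - 1 / 2)) * (norm (v - v0))\<^sup>2"
    using assms(1) unfolding strongly_convex_def by (elim allE ballE[where x = "1 / 2"]) auto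
  finally show ?thesis by (simp add: field_simps)
qed

text \<open>Sublevel sets are bounded, because at the midpoint of two far points the function would be
  negative.\<close>

lemma strongly_convex_attains_minimum:
  fixes \<psi> :: "'a::euclidean_space \<Rightarrow> real"
  assumes sc: "strongly_convex c \<psi>" "c > 0" and cont: "continuous_on UNIV \<psi>" and nonneg: "\<And>v. 0 \<le> \<psi> v"
    and S: "closed S" "v \<in> S"
  obtains v0 where "v0 \<in> S" "\<And>w. w \<in> S \<Longrightarrow> \<psi> v0 \<le> \<psi> w"
proof -
  define L where "L = S \<inter> {w. \<psi> w \<le> \<psi> v}"
  have "dist v w \<le> sqrt (4 * \<psi> v / c)" if "w \<in> L" for w
  proof -
    have "0 \<le> \<psi> ((1 - 1 / 2) *\<^sub>R v + (1 / 2) *\<^sub>R w)" by (rule nonneg)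
    also have "\<dots> \<le> (1 - 1 / 2) * \<psi> v + 1 / 2 * \<psi> w - c * (1 / 2 * (1 - 1 / 2)) * (norm (v - w))\<^sup>2"
      using sc(1) unfolding strongly_convex_def by (elim allE ballE[where x = "1 / 2"]) auto
    finally have "c * (norm (v - w))\<^sup>2 \<le> 4 * \<psi> v" using that by (simp add: L_def field_simps)
    then have "(norm (v - w))\<^sup>2 \<le> 4 * \<psi> v / c" using sc(2) by (simp add: field_simps)
    then show ?thesis by (simp add: dist_norm real_le_rsqrt)
  qed
  then have "bounded L" unfolding bounded_def by blast
  moreover have "closed L" unfolding L_def by (intro closed_Int S closed_Collect_le cont continuous_on_const)
  ultimately have "compact L" by (simp add: compact_eq_bounded_closed)
  moreover have "v \<in> L" by (simp add: L_def S)
  ultimately obtain v0 where "v0 \<in> L" "\<And>w. w \<in> L \<Longrightarrow> \<psi> v0 \<le> \<psi> w"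
    using continuous_attains_inf[of L \<psi>] continuous_on_subset[OF cont] by blast
  then have "v0 \<in> S" "\<psi> v0 \<le> \<psi> w" if "w \<in> S" for w
    using that by (auto simp: L_def) (meson linear order_trans)
  then show thesis using that S(2) by blast
qed

text \<open>The governor for an arbitrary strongly convex objective, so that both choices of \<open>\<psi>\<close> are covered at
  once.\<close>

locale governed_mpc = mpc A B C D Gx Gu P Q R K Y T N
  for A :: "real^'nx^'nx" and B :: "real^'nu^'nx"
    and C :: "real^'nx^'ny" and D :: "real^'nu^'ny"
    and Gx :: "real^'nv^'nx" and Gu :: "real^'nv^'nu"
    and P Q :: "real^'nx^'nx" and R :: "real^'nu^'nu" and K :: "real^'nx^'nu"
    and Y :: "(real^'ny) set" and T :: "((real^'nx) \<times> (real^'nv)) set" and N :: nat +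
  fixes F :: "((real^'nx) \<times> (real^'nv)) set" and V :: "(real^'nv) set"
    and \<psi> :: "real^'nv \<Rightarrow> real" and c :: real and vstar :: "real^'nv"
  assumes F: "F \<subseteq> params" "closed F" "convex F"
    and V: "closed V" "convex V"
    and V_output: "\<And>v. v \<in> V \<Longrightarrow> C *v (Gx *v v) + D *v (Gu *v v) \<in> Y"
    and V_interior: "\<And>v. v \<in> V \<Longrightarrow> (Gx *v v, v) \<in> interior F"
    and \<psi>: "strongly_convex c \<psi>" "c > 0" "continuous_on UNIV \<psi>" "\<And>v. 0 \<le> \<psi> v"
    and vstar: "vstar \<in> V" "\<And>v. v \<in> V \<Longrightarrow> \<psi> vstar \<le> \<psi> v"
begin

abbreviation "\<Phi> \<equiv> F \<inter> (UNIV \<times> V)"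
abbreviation "\<Lambda> \<equiv> params \<inter> (UNIV \<times> V)"
abbreviation "select \<equiv> fg_select \<psi> \<Phi>"
abbreviation "update \<equiv> fg_update \<psi> \<Phi>"

definition step :: "(real^'nx) \<times> (real^'nv) \<Rightarrow> (real^'nx) \<times> (real^'nv)" where
  "step = (\<lambda>(x, v). (closed_loop x v, update (closed_loop x v) v))"

abbreviation "target \<equiv> (Gx *v vstar, vstar)"

lemma V_admissible: "V \<subseteq> admissible"
  using V_output V_interior interior_subset F(1) unfolding admissible_def by blast

lemma vstar_gap: "v \<in> V \<Longrightarrow> \<psi> vstar + c / 2 * (norm (v - vstar))\<^sup>2 \<le> \<psi> v"
  using strongly_convex_minimizer_gap[OF \<psi>(1) V(2) vstar(1) _ vstar(2)] by blast

text \<open>The candidates \<open>{v. (x, v) \<in> \<Phi>}\<close> form a closed convex section, on which the strongly convex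
  objective has a minimizer with a quadratic gap.\<close>

lemma select_minimizes:
  assumes "(x, v) \<in> \<Phi>"
  shows select_in: "(x, select x) \<in> \<Phi>"
    and select_gap: "\<psi> (select x) + c / 2 * (norm (v - select x))\<^sup>2 \<le> \<psi> v"
proof -
  define S where "S = {v. (x, v) \<in> \<Phi>}"
  have S_eq: "S = Pair x -` F \<inter> V" by (auto simp: S_def)
  have "closed S"
    unfolding S_eq by (intro closed_Int V closed_vimage F(2) continuous_intros)
  moreover have cvx: "convex S"
  proof (rule convexI)
    fix p q :: "real^'nv" and s t :: real
    assume *: "p \<in> S" "q \<in> S" "0 \<le> s" "0 \<le> t" "s + t = 1"
    have "s *\<^sub>R (x, p) + t *\<^sub>R (x, q) \<in> F" using * by (intro convexD[OF F(3)]) (auto simp: S_def)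
    moreover have "s *\<^sub>R p + t *\<^sub>R q \<in> V" using * by (intro convexD[OF V(2)]) (auto simp: S_def)
    moreover have "s *\<^sub>R x + t *\<^sub>R x = x" using * by (metis scaleR_left_distrib scaleR_one)
    ultimately show "s *\<^sub>R p + t *\<^sub>R q \<in> S" by (simp add: S_def)
  qed
  moreover have v: "v \<in> S" using assms by (simp add: S_def)
  ultimately obtain v0 where "v0 \<in> S" "\<And>w. w \<in> S \<Longrightarrow> \<psi> v0 \<le> \<psi> w"
    using strongly_convex_attains_minimum[OF \<psi>] by metis
  then have "is_arg_min \<psi> (\<lambda>v. (x, v) \<in> \<Phi>) v0" unfolding is_arg_min_linorder S_def by blast
  then have "is_arg_min \<psi> (\<lambda>v. (x, v) \<in> \<Phi>) (select x)"
    unfolding fg_select_def arg_min_def by (rule someI)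
  then have sel: "select x \<in> S" "\<And>w. w \<in> S \<Longrightarrow> \<psi> (select x) \<le> \<psi> w"
    unfolding is_arg_min_linorder S_def by blast+
  show "(x, select x) \<in> \<Phi>" using sel(1) by (simp add: S_def)
  show "\<psi> (select x) + c / 2 * (norm (v - select x))\<^sup>2 \<le> \<psi> v"
    by (rule strongly_convex_minimizer_gap[OF \<psi>(1) cvx sel(1) v sel(2)])
qed

text \<open>This exact hit, rather than mere convergence, reduces stability to the case of a constant
  reference.\<close>

lemma select_eq_vstar:
  assumes "(x, vstar) \<in> F"
  shows "select x = vstar"
proof -
  have "(x, vstar) \<in> \<Phi>" using assms vstar(1) by simp
  from select_in[OF this] select_gap[OF this]
  have "select x \<in> V" "\<psi> (select x) + c / 2 * (norm (vstar - select x))\<^sup>2 \<le> \<psi> vstar" by auto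
  then have "c / 2 * (norm (vstar - select x))\<^sup>2 \<le> 0" using vstar(2)[of "select x"] by linarith
  then show ?thesis using \<psi>(2) by (simp add: mult_le_0_iff)
qed

lemma update_gap: "\<psi> (update x v) + c / 2 * (norm (v - update x v))\<^sup>2 \<le> \<psi> v"
  using select_gap[of x v] by (auto simp: fg_update_def)

lemma update_in: "(x, v) \<in> \<Lambda> \<Longrightarrow> (x, update x v) \<in> \<Lambda>"
  using select_in[of x v] F(1) by (auto simp: fg_update_def)

lemma step_in: "p \<in> \<Lambda> \<Longrightarrow> step p \<in> \<Lambda>"
  using closed_loop_descent(1) update_in by (cases p) (simp add: step_def)

lemma iterate_in: "p \<in> \<Lambda> \<Longrightarrow> (step ^^ k) p \<in> \<Lambda>"
proof (induction k)
  case (Suc k)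
  then show ?case using step_in[of "(step ^^ k) p"] by simp
qed simp

text \<open>The optimal value is zero at the target, hence also at its successor, where it bounds the distance
  to the target.\<close>

lemma step_target: "step target = target"
proof -
  have mem: "(Gx *v vstar, vstar) \<in> params" and adm: "vstar \<in> admissible"
    using V_admissible vstar(1) by (auto simp: admissible_def)
  obtain M where M: "M \<ge> 0" "\<And>x v. (x, v) \<in> params \<Longrightarrow> norm (x - Gx *v v) \<le> M * root_value x v"
    using norm_le_root_value by metis
  have "root_value (closed_loop (Gx *v vstar) vstar) vstar = 0"
    using root_value_closed_loop_le[OF mem] root_value_equilibrium[OF adm]
      root_value_nonneg[of "closed_loop (Gx *v vstar) vstar" vstar] by simp
  then have "closed_loop (Gx *v vstar) vstar = Gx *v vstar"
    using M(2)[OF closed_loop_descent(1)[OF mem]] by simp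
  moreover have "(Gx *v vstar, vstar) \<in> F"
    using V_interior[OF vstar(1)] interior_subset by blast
  ultimately show ?thesis
    using select_eq_vstar vstar(1) by (simp add: step_def fg_update_def)
qed

text \<open>The equilibria of references in a ball around \<open>v\<^sup>*\<close> form a compact subset of \<open>Int \<F>\<close>; without the
  bound on \<open>v\<close> the set of references need not be compact.\<close>

lemma uniform_margin:
  obtains \<rho> where "\<rho> > 0" "\<And>v x w. v \<in> V \<Longrightarrow> norm (v - vstar) \<le> b \<Longrightarrow>
      norm (x - Gx *v v) < \<rho> \<Longrightarrow> norm (w - v) < \<rho> \<Longrightarrow> (x, w) \<in> F"
proof -
  define W where "W = (\<lambda>v. (Gx *v v, v)) ` (V \<inter> cball vstar b)"
  have "compact W"
    unfolding W_def by (intro compact_continuous_image continuous_intros closed_Int_compact V compact_cball)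
  moreover have "W \<subseteq> interior F" unfolding W_def using V_interior by blast
  ultimately obtain e where e: "e > 0" "(\<Union>y\<in>W. ball y e) \<subseteq> interior F"
    using compact_subset_open_imp_ball_epsilon_subset[OF _ open_interior] by metis
  have "(x, w) \<in> F" if "v \<in> V" "norm (v - vstar) \<le> b" "norm (x - Gx *v v) < e / 2" "norm (w - v) < e / 2"
    for v x w
  proof -
    have "(Gx *v v, v) \<in> W" using that(1,2) by (auto simp: W_def dist_norm norm_minus_commute)
    moreover have "dist (Gx *v v, v) (x, w) < e"
      using norm_Pair_le[of "x - Gx *v v" "w - v"] that(3,4) by (simp add: dist_norm[of "(x, w)"] dist_commute)
    ultimately show ?thesis using e(2) interior_subset by (meson UN_I mem_ball subsetD)
  qed
  then show thesis using that[of "e / 2"] e(1) by simp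
qed

text \<open>Strong convexity makes the increments of the reference vanish, so the state tracks the equilibria;
  the uniform margin then lets every update move a fixed fraction \<open>t\<close> of the way to \<open>v\<^sup>*\<close>.\<close>

theorem step_converges:
  assumes "p \<in> \<Lambda>"
  shows "(\<lambda>k. (step ^^ k) p) \<longlonglongrightarrow> target"
proof -
  define x where "x k = fst ((step ^^ k) p)" for k
  define v where "v k = snd ((step ^^ k) p)" for k
  have pk: "(step ^^ k) p = (x k, v k)" for k by (simp add: x_def v_def)
  have mem: "(x k, v k) \<in> params" and vV: "v k \<in> V" for k
    using iterate_in[OF assms, of k] by (auto simp: pk)
  have x: "x (Suc k) = closed_loop (x k) (v k)" and v: "v (Suc k) = update (x (Suc k)) (v k)" for k
  proof -
    have "step (x k, v k) = (x (Suc k), v (Suc k))" using pk[of "Suc k"] pk[of k] by simp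
    then show "x (Suc k) = closed_loop (x k) (v k)" "v (Suc k) = update (x (Suc k)) (v k)"
      by (auto simp: step_def)
  qed
  define \<phi> where "\<phi> k = \<psi> (v k)" for k
  have gap: "\<phi> (Suc k) + c / 2 * (norm (v k - v (Suc k)))\<^sup>2 \<le> \<phi> k" for k
    using update_gap[of "x (Suc k)" "v k"] by (simp add: \<phi>_def v)
  have "decseq \<phi>"
  proof (rule decseq_SucI)
    fix k
    have "0 \<le> c / 2 * (norm (v k - v (Suc k)))\<^sup>2" using \<psi>(2) by simp
    with gap[of k] show "\<phi> (Suc k) \<le> \<phi> k" by linarith
  qed
  then obtain \<phi>0 where \<phi>0: "\<phi> \<longlonglongrightarrow> \<phi>0"
    using decseq_convergent[of \<phi> 0] \<psi>(4) unfolding \<phi>_def by blast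
  have "(\<lambda>k. 2 / c * (\<phi> k - \<phi> (Suc k))) \<longlonglongrightarrow> 0"
    using tendsto_mult_right_zero[OF tendsto_diff[OF \<phi>0 LIMSEQ_Suc[OF \<phi>0], simplified]] .
  then have "(\<lambda>k. (norm (v (Suc k) - v k))\<^sup>2) \<longlonglongrightarrow> 0"
  proof (rule Lim_null_comparison[rotated], intro always_eventually allI)
    fix k show "norm ((norm (v (Suc k) - v k))\<^sup>2) \<le> 2 / c * (\<phi> k - \<phi> (Suc k))"
      using gap[of k] \<psi>(2) by (simp add: norm_minus_commute field_simps)
  qed
  then have "(\<lambda>k. sqrt ((norm (v (Suc k) - v k))\<^sup>2)) \<longlonglongrightarrow> sqrt 0" by (rule tendsto_real_sqrt)
  then have slow: "(\<lambda>k. v (Suc k) - v k) \<longlonglongrightarrow> 0" by (simp add: tendsto_norm_zero_iff)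
  have track: "(\<lambda>k. x k - Gx *v v k) \<longlonglongrightarrow> 0"
    using V_admissible vV by (intro slow_reference_tracking x mem slow) auto
  have "(\<lambda>k. (x (Suc k) - Gx *v v (Suc k)) + Gx *v (v (Suc k) - v k)) \<longlonglongrightarrow> 0 + Gx *v 0"
    by (intro tendsto_add LIMSEQ_Suc[OF track] bounded_linear.tendsto[OF matrix_vector_mul_bounded_linear] slow)
  then have track': "(\<lambda>k. x (Suc k) - Gx *v v k) \<longlonglongrightarrow> 0"
    by (simp add: matrix_vector_mult_diff_distrib)
  (* The references stay in a sublevel set of the objective, hence in a ball around \<open>v\<^sup>*\<close>. *)
  define b where "b = sqrt (2 * \<phi> 0 / c)"
  have vb: "norm (v k - vstar) \<le> b" for k
  proof -
    have "c / 2 * (norm (v k - vstar))\<^sup>2 \<le> \<phi> k" using vstar_gap[OF vV[of k]] \<psi>(4)[of vstar] by (simp add: \<phi>_def)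
    also have "\<dots> \<le> \<phi> 0" using decseqD[OF \<open>decseq \<phi>\<close>] by simp
    finally have "(norm (v k - vstar))\<^sup>2 \<le> 2 * \<phi> 0 / c" using \<psi>(2) by (simp add: field_simps)
    then show ?thesis unfolding b_def by (rule real_le_rsqrt)
  qed
  obtain \<rho> where \<rho>: "\<rho> > 0" "\<And>v x w. v \<in> V \<Longrightarrow> norm (v - vstar) \<le> b \<Longrightarrow>
      norm (x - Gx *v v) < \<rho> \<Longrightarrow> norm (w - v) < \<rho> \<Longrightarrow> (x, w) \<in> F"
    using uniform_margin[of b] by metis
  have b0: "b \<ge> 0" using vb[of 0] norm_ge_zero order_trans by blast
  (* The fraction of the way to \<open>v\<^sup>*\<close> that the margin \<open>\<rho>\<close> allows from every reference visited. *)
  define t where "t = min 1 (\<rho> / (b + 1))"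
  have t: "0 < t" "t \<le> 1" "t * b < \<rho>"
  proof -
    show "0 < t" "t \<le> 1" using \<rho>(1) b0 by (simp_all add: t_def)
    have "t * b \<le> \<rho> / (b + 1) * b" using b0 by (intro mult_right_mono) (simp_all add: t_def)
    also have "\<dots> < \<rho>" using \<rho>(1) b0 by (simp add: field_simps)
    finally show "t * b < \<rho>" .
  qed
  have "\<forall>\<^sub>F k in sequentially. norm (x (Suc k) - Gx *v v k) < \<rho>"
    using order_tendstoD(2)[OF tendsto_norm_zero[OF track'] \<rho>(1)] .
  then obtain k0 where k0: "\<And>k. k \<ge> k0 \<Longrightarrow> norm (x (Suc k) - Gx *v v k) < \<rho>"
    by (auto simp: eventually_sequentially)
  have contract: "\<phi> (Suc k) - \<psi> vstar \<le> (1 - t) * (\<phi> k - \<psi> vstar)" if k: "k \<ge> k0" for k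
  proof -
    define w where "w = (1 - t) *\<^sub>R v k + t *\<^sub>R vstar"
    have wV: "w \<in> V" unfolding w_def using convexD[OF V(2) vV[of k] vstar(1), of "1 - t" t] t by simp
    have "w - v k = - t *\<^sub>R (v k - vstar)" by (simp add: w_def algebra_simps)
    then have "norm (w - v k) = t * norm (v k - vstar)" using t by simp
    also have "\<dots> \<le> t * b" using vb t by (intro mult_left_mono) auto
    finally have "norm (w - v k) < \<rho>" using t(3) by linarith
    then have "(x (Suc k), w) \<in> \<Phi>" "(x (Suc k), v k) \<in> \<Phi>"
      using \<rho>(2)[OF vV[of k] vb[of k] k0[OF k]] \<rho>(1) wV vV by auto
    then have "\<phi> (Suc k) + c / 2 * (norm (w - v (Suc k)))\<^sup>2 \<le> \<psi> w"
      using select_gap[of "x (Suc k)" w] unfolding \<phi>_def v fg_update_def by simp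
    moreover have "0 \<le> c / 2 * (norm (w - v (Suc k)))\<^sup>2" using \<psi>(2) by simp
    ultimately have "\<phi> (Suc k) \<le> \<psi> w" by linarith
    also have "\<dots> \<le> (1 - t) * \<phi> k + t * \<psi> vstar - c * (t * (1 - t)) * (norm (v k - vstar))\<^sup>2"
      unfolding w_def \<phi>_def using \<psi>(1) t by (simp add: strongly_convex_def)
    also have "\<dots> \<le> (1 - t) * \<phi> k + t * \<psi> vstar" using \<psi>(2) t by simp
    finally show ?thesis by (simp add: algebra_simps)
  qed
  have "(\<lambda>k. \<phi> (k + k0) - \<psi> vstar) \<longlonglongrightarrow> 0"
  proof (rule delayed_contraction_tendsto_zero[of 1 "1 - t" _ "\<lambda>_. 0"])
    show "0 \<le> \<phi> (k + k0) - \<psi> vstar" for k using vstar(2)[OF vV] by (simp add: \<phi>_def)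
    show "\<phi> (k + 1 + k0) - \<psi> vstar \<le> (1 - t) * (\<phi> (k + k0) - \<psi> vstar) + 0" for k
      using contract[of "k + k0"] by simp
  qed (use t in auto)
  then have "(\<lambda>k. \<phi> k - \<psi> vstar) \<longlonglongrightarrow> 0" by (rule LIMSEQ_offset)
  then have "(\<lambda>k. 2 / c * (\<phi> k - \<psi> vstar)) \<longlonglongrightarrow> 0" by (rule tendsto_mult_right_zero)
  then have "(\<lambda>k. (norm (v k - vstar))\<^sup>2) \<longlonglongrightarrow> 0"
  proof (rule Lim_null_comparison[rotated], intro always_eventually allI)
    fix k show "norm ((norm (v k - vstar))\<^sup>2) \<le> 2 / c * (\<phi> k - \<psi> vstar)"
      using vstar_gap[OF vV[of k]] \<psi>(2) by (simp add: \<phi>_def field_simps)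
  qed
  then have "(\<lambda>k. sqrt ((norm (v k - vstar))\<^sup>2)) \<longlonglongrightarrow> sqrt 0" by (rule tendsto_real_sqrt)
  then have "(\<lambda>k. v k - vstar) \<longlonglongrightarrow> 0" by (simp add: tendsto_norm_zero_iff)
  then have v_lim: "v \<longlonglongrightarrow> vstar" by (rule LIM_zero_cancel)
  have "(\<lambda>k. (x k - Gx *v v k) + Gx *v v k) \<longlonglongrightarrow> 0 + Gx *v vstar"
    by (intro tendsto_add track bounded_linear.tendsto[OF matrix_vector_mul_bounded_linear] v_lim)
  then have "x \<longlonglongrightarrow> Gx *v vstar" by simp
  with v_lim show ?thesis unfolding pk by (intro tendsto_Pair)
qed

text \<open>The first step is treated separately: it resets the reference to \<open>v\<^sup>*\<close> at the price of the factor
  \<open>k1\<close> in the distance. Afterwards the invariant is a bound on the value for the constant reference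
  \<open>v\<^sup>*\<close>.\<close>

lemma step_stable:
  assumes \<epsilon>: "\<epsilon> > 0"
  shows "\<exists>\<delta>>0. \<forall>p\<in>\<Lambda>. dist p target < \<delta> \<longrightarrow> (\<forall>k. dist ((step ^^ k) p) target < \<epsilon>)"
proof -
  obtain M where M: "M \<ge> 0" "\<And>x v. (x, v) \<in> params \<Longrightarrow> norm (x - Gx *v v) \<le> M * root_value x v"
    using norm_le_root_value by metis
  obtain c2 where c2: "c2 \<ge> 0"
    "\<And>x v. (x, v) \<in> params \<Longrightarrow> v \<in> admissible \<Longrightarrow> root_value x v \<le> c2 * norm (x - Gx *v v)"
    using root_value_le_norm by metis
  obtain \<rho> where \<rho>: "\<rho> > 0" "\<And>v x w. v \<in> V \<Longrightarrow> norm (v - vstar) \<le> 0 \<Longrightarrow>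
      norm (x - Gx *v v) < \<rho> \<Longrightarrow> norm (w - v) < \<rho> \<Longrightarrow> (x, w) \<in> F"
    using uniform_margin[of 0] by metis
  have near: "(x, w) \<in> F" if "norm (x - Gx *v vstar) < \<rho>" "norm (w - vstar) < \<rho>" for x w
    using \<rho>(2)[OF vstar(1)] that by simp
  have vadm: "vstar \<in> admissible" using V_admissible vstar(1) by blast
  define g where "g = onorm ((*v) Gx)"
  have g: "g \<ge> 0" by (simp add: g_def onorm_pos_le)
  define k1 where "k1 = M * c2 * (1 + g) + g"
  (* The three summands account for the initial state, its successor, and all later states. *)
  define k2 where "k2 = 1 + k1 + M * c2 * k1"
  have k1: "k1 \<ge> 0" using M(1) c2(1) g by (simp add: k1_def)
  have Mck1: "M * c2 * k1 \<ge> 0" using M(1) c2(1) k1 by simp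
  define r where "r = min \<rho> \<epsilon>"
  define \<delta> where "\<delta> = r / (2 * k2)"
  have r: "r > 0" using \<rho>(1) \<epsilon> by (simp add: r_def)
  have k2: "k2 \<ge> 1" using k1 Mck1 by (simp add: k2_def)
  have \<delta>: "\<delta> > 0" using r k2 by (simp add: \<delta>_def)
  have k2\<delta>: "k2 * \<delta> < r" using r k2 by (simp add: \<delta>_def)
  have d1: "\<delta> < r" "k1 * \<delta> < r" "M * c2 * k1 * \<delta> < r"
    using k2\<delta> mult_nonneg_nonneg[OF k1 less_imp_le[OF \<delta>]] mult_nonneg_nonneg[OF Mck1 less_imp_le[OF \<delta>]] \<delta>
    by (simp_all add: k2_def distrib_right)
  have "dist ((step ^^ k) p) target < \<epsilon>" if p: "p \<in> \<Lambda>" and dp: "dist p target < \<delta>" for p k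
  proof -
    obtain x0 v0 where p_eq: "p = (x0, v0)" by (cases p)
    have mem: "(x0, v0) \<in> params" "v0 \<in> V" using p p_eq by auto
    have dx: "norm (x0 - Gx *v vstar) < \<delta>" and dv: "norm (v0 - vstar) < \<delta>"
      using dp norm_fst_le[of "x0 - Gx *v vstar" "v0 - vstar"] norm_snd_le[of "v0 - vstar" "x0 - Gx *v vstar"]
      by (auto simp: p_eq dist_norm)
    define x1 where "x1 = closed_loop x0 v0"
    have Gd: "norm (Gx *v (v0 - vstar)) \<le> g * \<delta>"
      using onorm[of "(*v) Gx" "v0 - vstar"] mult_left_mono[OF less_imp_le[OF dv] g] by (simp add: g_def)
    have x0: "x0 - Gx *v v0 = (x0 - Gx *v vstar) - Gx *v (v0 - vstar)"
      by (simp add: matrix_vector_mult_diff_distrib)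
    have "norm (x0 - Gx *v v0) \<le> \<delta> + g * \<delta>"
      unfolding x0 using norm_triangle_ineq4[of "x0 - Gx *v vstar" "Gx *v (v0 - vstar)"] dx Gd by linarith
    then have "norm (x0 - Gx *v v0) \<le> (1 + g) * \<delta>" by (simp add: distrib_right)
    then have "c2 * norm (x0 - Gx *v v0) \<le> c2 * ((1 + g) * \<delta>)" by (rule mult_left_mono[OF _ c2(1)])
    moreover have "v0 \<in> admissible" using V_admissible mem(2) by blast
    ultimately have "root_value x0 v0 \<le> c2 * ((1 + g) * \<delta>)" using c2(2)[OF mem(1)] by linarith
    then have "root_value x1 v0 \<le> c2 * ((1 + g) * \<delta>)"
      unfolding x1_def using root_value_closed_loop_le[OF mem(1)] by linarith
    then have "M * root_value x1 v0 \<le> M * (c2 * ((1 + g) * \<delta>))" by (rule mult_left_mono[OF _ M(1)])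
    then have "norm (x1 - Gx *v v0) \<le> M * (c2 * ((1 + g) * \<delta>))"
      using M(2)[OF closed_loop_descent(1)[OF mem(1)]] unfolding x1_def by linarith
    moreover have "norm (x1 - Gx *v vstar) \<le> norm (x1 - Gx *v v0) + norm (Gx *v (v0 - vstar))"
      using norm_triangle_ineq[of "x1 - Gx *v v0" "Gx *v (v0 - vstar)"]
      by (simp add: matrix_vector_mult_diff_distrib)
    ultimately have "norm (x1 - Gx *v vstar) \<le> M * (c2 * ((1 + g) * \<delta>)) + g * \<delta>" using Gd by linarith
    then have x1: "norm (x1 - Gx *v vstar) \<le> k1 * \<delta>" by (simp add: k1_def algebra_simps)
    have "(x1, v0) \<in> F" "(x1, vstar) \<in> F"
      using near[of x1 v0] near[of x1 vstar] x1 d1 dv \<rho>(1) by (auto simp: r_def)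
    then have step1: "step p = (x1, vstar)"
      using mem(2) select_eq_vstar by (simp add: step_def p_eq x1_def[symmetric] fg_update_def)
    have x1p: "(x1, vstar) \<in> params" using \<open>(x1, vstar) \<in> F\<close> F(1) by blast
    have "root_value x1 vstar \<le> c2 * (k1 * \<delta>)"
      using c2(2)[OF x1p vadm] mult_left_mono[OF x1 c2(1)] by linarith
    then have inv: "\<exists>x. (step ^^ Suc k) p = (x, vstar) \<and> (x, vstar) \<in> params \<and> root_value x vstar \<le> c2 * (k1 * \<delta>)"
      for k
    proof (induction k)
      case 0
      then show ?case using step1 x1p by simp
    next
      case (Suc k)
      then obtain x where x: "(step ^^ Suc k) p = (x, vstar)" "(x, vstar) \<in> params"
        "root_value x vstar \<le> c2 * (k1 * \<delta>)" by blast
      define y where "y = closed_loop x vstar"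
      have y: "(y, vstar) \<in> params" "root_value y vstar \<le> c2 * (k1 * \<delta>)"
        using closed_loop_descent(1)[OF x(2)] root_value_closed_loop_le[OF x(2)] x(3) by (auto simp: y_def)
      have "norm (y - Gx *v vstar) < \<rho>"
        using M(2)[OF y(1)] mult_left_mono[OF y(2) M(1)] d1(3) by (simp add: r_def mult.assoc)
      then have "(y, vstar) \<in> F" using near \<rho>(1) by simp
      then have "step (x, vstar) = (y, vstar)"
        using select_eq_vstar vstar(1) by (simp add: step_def y_def[symmetric] fg_update_def)
      then show ?case using x(1) y by simp
    qed
    show ?thesis
    proof (cases k)
      case 0
      then show ?thesis using dp d1(1) by (simp add: r_def)
    next
      case (Suc j)
      obtain x where x: "(step ^^ k) p = (x, vstar)" "(x, vstar) \<in> params"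
        "root_value x vstar \<le> c2 * (k1 * \<delta>)" using inv[of j] Suc by blast
      have "norm (x - Gx *v vstar) < \<epsilon>"
        using M(2)[OF x(2)] mult_left_mono[OF x(3) M(1)] d1(3) by (simp add: r_def mult.assoc)
      then show ?thesis using x(1) by (simp add: dist_norm norm_Pair)
    qed
  qed
  with \<delta> show ?thesis by blast
qed

theorem governed_asymptotically_stable: "asymp_stable_equilibrium \<Lambda> step target"
proof -
  have "target \<in> \<Lambda>" using V_admissible vstar(1) by (auto simp: admissible_def)
  moreover have "step ` \<Lambda> \<subseteq> \<Lambda>" using step_in by blast
  ultimately show ?thesis
    unfolding asymp_stable_equilibrium_def
    using step_target step_stable step_converges by (metis zero_less_one)
qed

end

lemma kernel_equilibrium:
  assumes "columns_basis Gx Gu Gz (eq_kernel A B E F)"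
  shows "A *v (Gx *v v) + B *v (Gu *v v) = Gx *v v"
proof -
  have "(Gx *v v, Gu *v v, Gz *v v) = (\<Sum>j\<in>UNIV. v $ j *\<^sub>R block_column Gx Gu Gz j)"
    by (simp add: block_column_def matrix_mult_sum scalar_mult_eq_scaleR prod_eq_iff fst_sum snd_sum)
  also have "\<dots> \<in> span (range (block_column Gx Gu Gz))"
    by (intro span_sum span_scale span_base) auto
  finally have "(Gx *v v, Gu *v v, Gz *v v) \<in> eq_kernel A B E F"
    using assms by (simp add: columns_basis_def)
  then have "(A - mat 1) *v (Gx *v v) + B *v (Gu *v v) = 0" by (simp add: eq_kernel_def)
  then show ?thesis
    unfolding matrix_vector_mult_diff_rdistrib matrix_vector_mul_lid by (simp add: algebra_simps)
qed

text \<open>If \<open>G\<^sub>z\<close> is not injective, the objective is the squared distance to \<open>v\<^sup>*\<close>, which is the case of the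
  identity map.\<close>

lemma fg_objective_strongly_convex:
  fixes Gz :: "real^'nv^'nz"
  shows "\<exists>c>0. strongly_convex c (fg_objective Gz vstar r)"
    and "continuous_on UNIV (fg_objective Gz vstar r)"
    and "0 \<le> fg_objective Gz vstar r v"
proof -
  show "\<exists>c>0. strongly_convex c (fg_objective Gz vstar r)"
  proof (cases "inj ((*v) Gz)")
    case True
    then have "fg_objective Gz vstar r = (\<lambda>v. (norm (Gz *v v - r))\<^sup>2)" by (simp add: fg_objective_def fun_eq_iff)
    then show ?thesis using strongly_convex_sq_norm[OF matrix_vector_mul_linear True] by simp
  next
    case False
    then have "fg_objective Gz vstar r = (\<lambda>v. (norm (id v - vstar))\<^sup>2)" by (simp add: fg_objective_def fun_eq_iff)
    then show ?thesis using strongly_convex_sq_norm[OF linear_id inj_on_id] by metis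
  qed
  show "continuous_on UNIV (fg_objective Gz vstar r)"
    unfolding fg_objective_def by (cases "inj ((*v) Gz)") (simp_all add: continuous_intros)
  show "0 \<le> fg_objective Gz vstar r v" by (simp add: fg_objective_def)
qed

theorem theorem3:
  fixes A :: "real^'nx^'nx" and B :: "real^'nu^'nx"
    and C :: "real^'nx^'ny" and D :: "real^'nu^'ny"
    and E :: "real^'nx^'nz" and F :: "real^'nu^'nz"
    and Gx :: "real^'nv^'nx" and Gu :: "real^'nv^'nu" and Gz :: "real^'nv^'nz"
    and Gy :: "real^'nv^'ny"
    and P Q :: "real^'nx^'nx" and R :: "real^'nu^'nu" and K :: "real^'nx^'nu"
    and Y :: "(real^'ny) set" and T \<F> \<Gamma> \<Sigma> \<Phi> \<Lambda> :: "((real^'nx) \<times> (real^'nv)) set"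
    and V :: "(real^'nv) set"
    and eps :: real and N :: nat and r :: "real^'nz" and vstar :: "real^'nv"
    and f :: "real^'nx \<Rightarrow> real^'nv \<Rightarrow> real^'nx" and g :: "real^'nx \<Rightarrow> real^'nv \<Rightarrow> real^'nv"
    and gbar :: "real^'nx \<Rightarrow> real^'nv"
  defines "Gy \<equiv> C ** Gx + D ** Gu"
  defines "V \<equiv> admissible_refs Gy eps Y"
  defines "\<Sigma> \<equiv> eq_manifold Gx V"
  defines "\<Gamma> \<equiv> ocp_params A B C D Y T N"
  defines "\<Phi> \<equiv> \<F> \<inter> (UNIV \<times> V)"
  defines "\<Lambda> \<equiv> \<Gamma> \<inter> (UNIV \<times> V)"
  defines "f \<equiv> \<lambda>x v. A *v x + B *v mpc_law A B C D Gx Gu Y T P Q R N x v"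
  defines "gbar \<equiv> fg_select (fg_objective Gz vstar r) \<Phi>"
  defines "g \<equiv> fg_update (fg_objective Gz vstar r) \<Phi>"
  assumes basis: "columns_basis Gx Gu Gz (eq_kernel A B E F)"
    and eps: "0 < eps" "eps < 1"
    and horizon: "1 \<le> N"
    and stab: "stabilizable A B"
    and Y: "compact Y" "polyhedron Y" "0 \<in> interior Y"
    and Gz: "full_rank Gz"
    and QR: "sym_psd Q" "observable A Q" "sym_pd R"
    and P: "sym_psd P"
    and T: "polyhedron T"
    and terminal_decrease: "\<And>x v. (x, v) \<in> T \<Longrightarrow>
          (wnorm P ((A - B ** K) *v (x - Gx *v v)))\<^sup>2 - (wnorm P (x - Gx *v v))\<^sup>2
            \<le> - (wnorm (Q + transpose K ** R ** K) (x - Gx *v v))\<^sup>2"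
    and terminal_invariant: "\<And>x v. (x, v) \<in> T \<Longrightarrow>
          (A *v x + B *v terminal_law Gx Gu K x v, v) \<in> T"
    and terminal_constraint: "\<And>x v. (x, v) \<in> T \<Longrightarrow>
          C *v x + D *v terminal_law Gx Gu K x v \<in> Y"
    and Sigma_Gamma: "\<Sigma> \<subseteq> interior \<Gamma>"
    and \<F>: "\<F> \<subseteq> \<Gamma>" "closed \<F>" "convex \<F>" "polyhedron \<F>" "\<Sigma> \<subseteq> interior \<F>"
    and vstar: "is_arg_min (\<lambda>v. (norm (Gz *v v - r))\<^sup>2) (\<lambda>v. v \<in> V) vstar"
  shows "asymp_stable_equilibrium \<Lambda> (\<lambda>(x, v). (f x v, g (f x v) v)) (Gx *v vstar, vstar) \<and>
    (\<forall>x v. x 0 \<in> fst ` \<Phi> \<and> v 0 = gbar (x 0) \<and>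
       (\<forall>k. x (Suc k) = f (x k) (v k) \<and> v (Suc k) = g (x (Suc k)) (v k)) \<longrightarrow>
       (\<lambda>k. (x k, v k)) \<longlonglongrightarrow> (Gx *v vstar, vstar))"
proof -
  obtain c where c: "c > 0" "strongly_convex c (fg_objective Gz vstar r)"
    using fg_objective_strongly_convex(1)[of Gz vstar r] by metis
  have V_vimage: "V = (*v) Gy -` ((*\<^sub>R) (1 - eps) ` Y)"
    by (auto simp: V_def admissible_refs_def)
  have V_in_Y: "Gy *v v \<in> Y" if "v \<in> V" for v
  proof -
    obtain y where y: "y \<in> Y" "Gy *v v = (1 - eps) *\<^sub>R y"
      using \<open>v \<in> V\<close> by (auto simp: V_def admissible_refs_def)
    have "0 \<in> Y" using Y(3) interior_subset by blast
    then have "(1 - eps) *\<^sub>R y + eps *\<^sub>R 0 \<in> Y"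
      using eps y(1) by (intro convexD[OF polyhedron_imp_convex[OF Y(2)]]) auto
    then show ?thesis using y(2) by simp
  qed
  have vstarV: "vstar \<in> V" and vstar_min: "\<And>v. v \<in> V \<Longrightarrow> norm (Gz *v vstar - r) ^ 2 \<le> norm (Gz *v v - r) ^ 2"
    using vstar by (auto simp: is_arg_min_linorder)
  interpret governed_mpc A B C D Gx Gu P Q R K Y T N \<F> V "fg_objective Gz vstar r" c vstar
  proof unfold_locales
    show "closed V"
      unfolding V_vimage
      by (intro closed_vimage closed_scaling compact_imp_closed Y(1) linear_continuous_on) simp
    show "convex V"
      unfolding V_vimage
      by (intro convex_linear_vimage convex_scaling polyhedron_imp_convex Y(2)) simp
    show "C *v (Gx *v v) + D *v (Gu *v v) \<in> Y" if "v \<in> V" for v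
      using V_in_Y[OF that] by (simp add: Gy_def matrix_vector_mult_add_rdistrib flip: matrix_vector_mul_assoc)
    show "(Gx *v v, v) \<in> interior \<F>" if "v \<in> V" for v
      using \<F>(5) that by (auto simp: \<Sigma>_def eq_manifold_def)
    show "fg_objective Gz vstar r vstar \<le> fg_objective Gz vstar r v" if "v \<in> V" for v
      using vstar_min[OF that] by (simp add: fg_objective_def)
  qed (use kernel_equilibrium[OF basis] horizon Y(2) QR P T terminal_decrease terminal_invariant
      terminal_constraint \<F> c vstarV fg_objective_strongly_convex in \<open>simp_all add: \<Gamma>_def\<close>)
  have f: "f = closed_loop"
    by (simp add: f_def closed_loop_def optimal_input_def mpc_law_def fun_eq_iff)
  have \<Lambda>_eq: "\<Lambda> = ocp_params A B C D Y T N \<inter> (UNIV \<times> V)" by (simp add: \<Lambda>_def \<Gamma>_def)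
  have sys: "(\<lambda>(x, v). (f x v, g (f x v) v)) = step"
    by (simp add: step_def f g_def \<Phi>_def)
  show ?thesis
  proof (intro conjI allI impI)
    show "asymp_stable_equilibrium \<Lambda> (\<lambda>(x, v). (f x v, g (f x v) v)) (Gx *v vstar, vstar)"
      unfolding sys \<Lambda>_eq by (rule governed_asymptotically_stable)
  next
    fix x v
    assume traj: "x 0 \<in> fst ` \<Phi> \<and> v 0 = gbar (x 0) \<and>
       (\<forall>k. x (Suc k) = f (x k) (v k) \<and> v (Suc k) = g (x (Suc k)) (v k))"
    then obtain w where "(x 0, w) \<in> \<Phi>" by auto
    then have "(x 0, v 0) \<in> \<Phi>"
      using traj select_in unfolding gbar_def \<Phi>_def by metis
    then have "(x 0, v 0) \<in> \<Lambda>" using \<F>(1) by (auto simp: \<Lambda>_def \<Phi>_def)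
    moreover have "(step ^^ k) (x 0, v 0) = (x k, v k)" for k
    proof (induction k)
      case (Suc k)
      have "(step ^^ Suc k) (x 0, v 0) = step (x k, v k)" using Suc by simp
      also have "\<dots> = (x (Suc k), v (Suc k))" using traj by (simp flip: sys)
      finally show ?case .
    qed simp
    ultimately show "(\<lambda>k. (x k, v k)) \<longlonglongrightarrow> (Gx *v vstar, vstar)"
      using step_converges[of "(x 0, v 0)"] unfolding \<Lambda>_eq by simp
  qed
qed

end
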